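(* Let $G$ be an infinite, connected, vertex-transitive, $d$-regular directed graph (with symmetric edge set), and assume $G$ is amenable. Let $\tilde N$ be the number of infinite strong clusters. If $\tilde\theta(G,{\bf p})>0$, $p_0+p_1>0$, $p_2>0$ and $p_3+\cdots+p_d>0$, then $P_{\bf p}(\tilde N=1)=1$.
   Context: $G=(V,E,o)$ is an infinite simple directed graph with origin $o\in V$: $V$ is countably infinite, $E\subset V\times V\setminus\{(x,x)\}$, and $(x,y)\in E$ iff $(y,x)\in E$; $x\sim y$ means $(x,y)\in E$; $L_x=\{y:(x,y)\in E\}$. $G$ is $d$-regular ($|L_x|=d$ for all $x$), connected with respect to $\sim$, and vertex-transitive (automorphisms act transitively on $V$). $G$ is amenable if there exist non-empty finite subsets $F(n)\subset V$ with $\limsup_{n\to\infty}|\partial F(n)|/|F(n)|=0$, where $\partial F(n)=\{x\in F(n):\text{there is }y\in V\setminus F(n)\text{ with }x\sim y\}$. Let ${\bf p}=(p_0,\dots,p_d)$ with $p_i\ge0$ and $\sum_i p_i=1$. Configurations are $\omega\in\Omega=\prod_{x\in V}2^{L_x}$ with the $\sigma$-field generated by finite-dimensional cylinders; $P_{\bf p}$ is the product measure under which the states $\omega(x)\subset L_x$ are independent with $P_{\bf p}(\omega(x)=S)=p_{|S|}/\binom{d}{|S|}$ for $S\subset L_x$. Put $E_\omega=\{(x,y):x\in V,\ y\in\omega(x)\}$. Vertices $x,y$ are strongly connected if $x=y$ or there are $x=z_0,\dots,z_m=y$ such that for each $i$, both $(z_i,z_{i+1})\in E_\omega$ and $(z_{i+1},z_i)\in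 E_\omega$. Strong clusters are the equivalence classes of strong connection. $\tilde C$ is the strong cluster of $o$ and $\tilde\theta(G,{\bf p})=P_{\bf p}(|\tilde C|=\infty)$. *)

theory Defs
  imports "HOL-Probability.Probability"
begin

section \<open>Rooted directed graphs with symmetric edge set\<close>

locale directed_graph =
  fixes V :: "'a set" and E :: "('a \<times> 'a) set" and orig :: 'a
  assumes orig_in_V: "orig \<in> V"
    and countable_V: "countable V"
    and infinite_V: "infinite V"
    and E_subset: "E \<subseteq> V \<times> V - Id"
    and sym_E: "sym E"

definition nbrs :: "('a \<times> 'a) set \<Rightarrow> 'a \<Rightarrow> 'a set" where
  "nbrs E x = {y. (x, y) \<in> E}"

text \<open>Finiteness is stated separately because \<^term>\<open>card A = 0\<close> for infinite \<open>A\<close>.\<close>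

definition regular_graph :: "'a set \<Rightarrow> ('a \<times> 'a) set \<Rightarrow> nat \<Rightarrow> bool" where
  "regular_graph V E d \<longleftrightarrow> (\<forall>x\<in>V. finite (nbrs E x) \<and> card (nbrs E x) = d)"

definition connected_graph :: "'a set \<Rightarrow> ('a \<times> 'a) set \<Rightarrow> bool" where
  "connected_graph V E \<longleftrightarrow> (\<forall>x\<in>V. \<forall>y\<in>V. (x, y) \<in> E\<^sup>*)"

definition graph_automorphism :: "'a set \<Rightarrow> ('a \<times> 'a) set \<Rightarrow> ('a \<Rightarrow> 'a) \<Rightarrow> bool" where
  "graph_automorphism V E f \<longleftrightarrow>
     bij_betw f V V \<and> (\<forall>x\<in>V. \<forall>y\<in>V. (f x, f y) \<in> E \<longleftrightarrow> (x, y) \<in> E)"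

definition vertex_transitive :: "'a set \<Rightarrow> ('a \<times> 'a) set \<Rightarrow> bool" where
  "vertex_transitive V E \<longleftrightarrow>
     (\<forall>x\<in>V. \<forall>y\<in>V. \<exists>f. graph_automorphism V E f \<and> f x = y)"

definition inner_boundary :: "'a set \<Rightarrow> ('a \<times> 'a) set \<Rightarrow> 'a set \<Rightarrow> 'a set" where
  "inner_boundary V E F = {x \<in> F. \<exists>y \<in> V - F. (x, y) \<in> E}"

definition amenable :: "'a set \<Rightarrow> ('a \<times> 'a) set \<Rightarrow> bool" where
  "amenable V E \<longleftrightarrow>
     (\<exists>F :: nat \<Rightarrow> 'a set.
        (\<forall>n. F n \<subseteq> V \<and> finite (F n) \<and> F n \<noteq> {}) \<and>
        limsup (\<lambda>n. ereal (real (card (inner_boundary V E (F n))) / real (card (F n)))) = 0)"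

section \<open>The random configuration\<close>

text \<open>A vector \<open>(p\<^sub>0, \<dots>, p\<^sub>d)\<close> is a function on \<^typ>\<open>nat\<close>; its values beyond \<open>d\<close> are irrelevant.\<close>

definition prob_vector :: "nat \<Rightarrow> (nat \<Rightarrow> real) \<Rightarrow> bool" where
  "prob_vector d p \<longleftrightarrow> (\<forall>i\<le>d. 0 \<le> p i) \<and> (\<Sum>i\<le>d. p i) = 1"

definition vertex_law :: "nat \<Rightarrow> (nat \<Rightarrow> real) \<Rightarrow> 'a set \<Rightarrow> 'a set measure" where
  "vertex_law d p L = point_measure (Pow L) (\<lambda>S. ennreal (p (card S) / real (d choose card S)))"

definition config_measure ::
  "'a set \<Rightarrow> ('a \<times> 'a) set \<Rightarrow> nat \<Rightarrow> (nat \<Rightarrow> real) \<Rightarrow> ('a \<Rightarrow> 'a set) measure" where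
  "config_measure V E d p = (\<Pi>\<^sub>M x\<in>V. vertex_law d p (nbrs E x))"

lemma prob_space_vertex_law:
  assumes "finite L" "card L = d" "prob_vector d p"
  shows "prob_space (vertex_law d p L)"
proof (rule prob_spaceI)
  let ?w = "\<lambda>k. p k / real (d choose k)"
  have p0: "0 \<le> p i" if "i \<le> d" for i
    using assms that by (simp add: prob_vector_def)
  have card_le: "card S \<le> d" if "S \<in> Pow L" for S
    using that assms card_mono by blast
  have "(\<Sum>S\<in>Pow L. ?w (card S)) = (\<Sum>k\<le>d. \<Sum>S\<in>{S \<in> Pow L. card S = k}. ?w (card S))"
    using assms card_le by (intro sum.group[symmetric]) auto
  also have "\<dots> = (\<Sum>k\<le>d. real (card {S \<in> Pow L. card S = k}) * ?w k)"
    by (intro sum.cong) auto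
  also have "\<dots> = (\<Sum>k\<le>d. p k)"
    using assms by (intro sum.cong) (auto simp: n_subsets Pow_def)
  finally have sum1: "(\<Sum>S\<in>Pow L. ?w (card S)) = 1"
    using assms by (simp add: prob_vector_def)
  have "emeasure (vertex_law d p L) (Pow L) = (\<Sum>S\<in>Pow L. ennreal (?w (card S)))"
    unfolding vertex_law_def using assms by (intro emeasure_point_measure_finite) auto
  also have "\<dots> = ennreal (\<Sum>S\<in>Pow L. ?w (card S))"
    by (intro sum_ennreal divide_nonneg_nonneg p0 card_le) auto
  finally show "emeasure (vertex_law d p L) (space (vertex_law d p L)) = 1"
    by (simp add: sum1 vertex_law_def space_point_measure)
qed

lemma prob_space_config_measure:
  assumes "regular_graph V E d" "prob_vector d p"
  shows "prob_space (config_measure V E d p)"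
  unfolding config_measure_def
  using assms by (intro prob_space_PiM prob_space_vertex_law) (auto simp: regular_graph_def)

section \<open>Strong clusters\<close>

definition config_edges :: "'a set \<Rightarrow> ('a \<Rightarrow> 'a set) \<Rightarrow> ('a \<times> 'a) set" where
  "config_edges V \<omega> = {(x, y). x \<in> V \<and> y \<in> \<omega> x}"

definition strong_connection :: "'a set \<Rightarrow> ('a \<Rightarrow> 'a set) \<Rightarrow> ('a \<times> 'a) set" where
  "strong_connection V \<omega> =
     {(x, y) \<in> V \<times> V. (x, y) \<in> {(u, v). (u, v) \<in> config_edges V \<omega> \<and> (v, u) \<in> config_edges V \<omega>}\<^sup>*}"

definition strong_clusters :: "'a set \<Rightarrow> ('a \<Rightarrow> 'a set) \<Rightarrow> 'a set set" where
  "strong_clusters V \<omega> = V // strong_connection V \<omega>"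

definition strong_cluster_of :: "'a set \<Rightarrow> ('a \<Rightarrow> 'a set) \<Rightarrow> 'a \<Rightarrow> 'a set" where
  "strong_cluster_of V \<omega> x = strong_connection V \<omega> `` {x}"

definition num_infinite_strong_clusters :: "'a set \<Rightarrow> ('a \<Rightarrow> 'a set) \<Rightarrow> enat" where
  "num_infinite_strong_clusters V \<omega> =
     (let \<C> = {C \<in> strong_clusters V \<omega>. infinite C}
      in if finite \<C> then enat (card \<C>) else \<infinity>)"

definition strong_percolation_prob ::
  "'a set \<Rightarrow> ('a \<times> 'a) set \<Rightarrow> 'a \<Rightarrow> nat \<Rightarrow> (nat \<Rightarrow> real) \<Rightarrow> real" where
  "strong_percolation_prob V E orig d p =
     \<P>(\<omega> in config_measure V E d p. infinite (strong_cluster_of V \<omega> orig))"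

end

theory Submission
  imports Defs
begin

text \<open>
  Call two vertices adjacent in a configuration if each belongs to the state of the other; strong
  clusters are the components of this locally finite random graph. By ergodicity of the product
  measure under automorphisms, having at least \<open>m\<close> infinite clusters is an event of probability \<open>0\<close>
  or \<open>1\<close>. Almost surely every almost sure property survives all changes of finitely many states to
  states of positive weight. Given \<open>m \<le> 3\<close> infinite clusters, delete a finite connected set \<open>B\<close> of
  vertices meeting all of them, and then return the vertices of \<open>B\<close> one at a time, starting with
  non-cut vertices of \<open>B\<close>: a state of size \<open>2\<close> extends an infinite branch to a neighbour in \<open>B\<close>, and
  a state of size at most \<open>1\<close> never joins two branches. In the end a single vertex \<open>u\<close> is surrounded
  by \<open>m\<close> distinct infinite branches. For \<open>m = 2\<close>, giving \<open>u\<close> a state of size \<open>2\<close> yields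
  fewer infinite clusters than a state of size at most \<open>1\<close>, which excludes a finite number \<open>k \<ge> 2\<close>
  of infinite clusters. For \<open>m = 3\<close>, a state of size at least \<open>3\<close> makes \<open>u\<close> a trifurcation; by
  Burton and Keane a finite set \<open>F\<close> contains at most \<open>2 |\<partial>F|\<close> trifurcations, so amenability
  makes trifurcations null and excludes infinitely many infinite clusters.
\<close>

section \<open>Vertex deletion and infinite branches\<close>

text \<open>Deleted vertices remain as isolated points, because the reflexive closure still relates
  each to itself. This is why start points are often asked to lie outside \<open>B\<close> or to
  have an infinite component.\<close>

definition off :: "('a \<times> 'a) set \<Rightarrow> 'a set \<Rightarrow> ('a \<times> 'a) set" where
  "off R B = {(u, v) \<in> R. u \<notin> B \<and> v \<notin> B}"

lemma off_subset: "off R B \<subseteq> R"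
  by (auto simp: off_def)

lemma off_off: "off (off R B) C = off R (B \<union> C)"
  by (auto simp: off_def)

lemma sym_off: "sym R \<Longrightarrow> sym (off R B)"
  by (auto simp: off_def sym_def)

lemma off_rtrancl_subset: "(x, y) \<in> (off R B)\<^sup>* \<Longrightarrow> (x, y) \<in> R\<^sup>*"
  using rtrancl_mono[OF off_subset] by blast

lemma sym_rtranclD: "sym R \<Longrightarrow> (x, y) \<in> R\<^sup>* \<Longrightarrow> (y, x) \<in> R\<^sup>*"
  by (meson symD sym_rtrancl)

lemma off_rtrancl_notin: "(x, y) \<in> (off R B)\<^sup>* \<Longrightarrow> x \<notin> B \<Longrightarrow> y \<notin> B"
  by (induction rule: rtrancl_induct) (auto simp: off_def)

lemma rtrancl_in_carrier: "(x, y) \<in> R\<^sup>* \<Longrightarrow> R \<subseteq> V \<times> V \<Longrightarrow> x \<in> V \<Longrightarrow> y \<in> V"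
  by (induction rule: rtrancl_induct) auto

lemma rtrancl_outside_carrier: "(x, y) \<in> R\<^sup>* \<Longrightarrow> R \<subseteq> V \<times> V \<Longrightarrow> x \<notin> V \<Longrightarrow> y = x"
  by (induction rule: rtrancl_induct) auto

lemma infinite_cluster_in_carrier:
  assumes "infinite (R\<^sup>* `` {x})" "R \<subseteq> V \<times> V"
  shows "x \<in> V"
proof (rule ccontr)
  assume "x \<notin> V"
  then have "R\<^sup>* `` {x} \<subseteq> {x}" using rtrancl_outside_carrier[OF _ assms(2)] by blast
  then show False using assms(1) finite_subset by blast
qed

text \<open>Cut the path at its last visit to \<open>B\<close>. In the induction along the path,
  each step out of \<open>B\<close> starts a new tail, and each step outside \<open>B\<close>
  prolongs the current one.\<close>

lemma last_exit:
  assumes "(x, z) \<in> R\<^sup>*" "x \<in> B" "z \<notin> B"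
  obtains b y where "(x, b) \<in> R\<^sup>*" "b \<in> B" "(b, y) \<in> R" "y \<notin> B" "(y, z) \<in> (off R B)\<^sup>*"
proof -
  have "z \<in> B \<or> (\<exists>b y. (x, b) \<in> R\<^sup>* \<and> b \<in> B \<and> (b, y) \<in> R \<and> y \<notin> B \<and> (y, z) \<in> (off R B)\<^sup>*)"
    using assms(1)
  proof (induction rule: rtrancl_induct)
    case base
    then show ?case using assms by simp
  next
    case (step u v)
    show ?case
    proof (cases "v \<in> B")
      case False
      show ?thesis
      proof (cases "u \<in> B")
        case True
        then show ?thesis using step False by blast
      next
        case u: False
        then have "(u, v) \<in> off R B" using step False by (simp add: off_def)
        then show ?thesis using step.IH u by (meson rtrancl.rtrancl_into_rtrancl)
      qed
    qed simp
  qed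
  then show ?thesis using that assms(3) by blast
qed

text \<open>By local finiteness only finitely many edges leave \<open>B\<close>. They split the
  cluster outside \<open>B\<close> into finitely many branches, so one branch is infinite.\<close>

lemma infinite_branch:
  assumes fin: "\<And>v. finite (R `` {v})" and B: "finite B"
    and inf: "infinite (R\<^sup>* `` {x})" and x: "x \<in> B"
  obtains b y where "(x, b) \<in> R\<^sup>*" "b \<in> B" "(b, y) \<in> R" "y \<notin> B" "infinite ((off R B)\<^sup>* `` {y})"
proof -
  define Y where "Y = {(b, y). (x, b) \<in> R\<^sup>* \<and> b \<in> B \<and> (b, y) \<in> R \<and> y \<notin> B}"
  have "Y \<subseteq> (SIGMA b:B. R `` {b})" by (auto simp: Y_def)
  then have finY: "finite Y" using B fin by (meson finite_SigmaI finite_subset)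
  have "R\<^sup>* `` {x} \<subseteq> B \<union> (\<Union>(b, y)\<in>Y. (off R B)\<^sup>* `` {y})"
  proof
    fix z assume "z \<in> R\<^sup>* `` {x}"
    then have xz: "(x, z) \<in> R\<^sup>*" by simp
    show "z \<in> B \<union> (\<Union>(b, y)\<in>Y. (off R B)\<^sup>* `` {y})"
    proof (cases "z \<in> B")
      case False
      then obtain b y where "(x, b) \<in> R\<^sup>*" "b \<in> B" "(b, y) \<in> R" "y \<notin> B" "(y, z) \<in> (off R B)\<^sup>*"
        using last_exit[OF xz x] by blast
      then show ?thesis by (auto simp: Y_def)
    qed simp
  qed
  then have "infinite (\<Union>(b, y)\<in>Y. (off R B)\<^sup>* `` {y})"
    using inf B by (meson finite_Un finite_subset)
  then obtain b y where "(b, y) \<in> Y" "infinite ((off R B)\<^sup>* `` {y})"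
    using finY by fastforce
  then show ?thesis using that by (auto simp: Y_def)
qed

text \<open>A cluster that misses \<open>B\<close> is unaffected by the deletion. One that meets
  \<open>B\<close> is also the cluster of a vertex of \<open>B\<close>, where
  \<open>infinite_branch\<close> applies.\<close>

lemma infinite_cluster_off:
  assumes fin: "\<And>v. finite (R `` {v})" and B: "finite B" and R: "sym R"
    and inf: "infinite (R\<^sup>* `` {x})"
  obtains y where "(x, y) \<in> R\<^sup>*" "y \<notin> B" "infinite ((off R B)\<^sup>* `` {y})"
proof (cases "\<exists>b\<in>B. (x, b) \<in> R\<^sup>*")
  case True
  then obtain b where b: "b \<in> B" "(x, b) \<in> R\<^sup>*" by blast
  have "R\<^sup>* `` {x} \<subseteq> R\<^sup>* `` {b}"
    using b R by (auto dest: sym_rtranclD intro: rtrancl_trans)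
  then have "infinite (R\<^sup>* `` {b})" using inf finite_subset by blast
  then show ?thesis
    using infinite_branch[OF fin B _ b(1)] that b(2)
    by (metis rtrancl.rtrancl_into_rtrancl rtrancl_trans)
next
  case False
  have "(x, z) \<in> (off R B)\<^sup>*" if "(x, z) \<in> R\<^sup>*" for z
    using that
  proof (induction rule: rtrancl_induct)
    case (step u v)
    then have "u \<notin> B" "v \<notin> B" using False by (blast, meson False rtrancl.rtrancl_into_rtrancl)
    then show ?case using step by (simp add: off_def rtrancl.rtrancl_into_rtrancl)
  qed simp
  then have "R\<^sup>* `` {x} \<subseteq> (off R B)\<^sup>* `` {x}" by auto
  then have "infinite ((off R B)\<^sup>* `` {x})" using inf finite_subset by blast
  then show ?thesis using that[of x] False by blast
qed

text \<open>A path that enters \<open>b\<close> must leave through the neighbour it came from, so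
  the detour can be cut out. This is how a state of size at most one keeps branches apart.\<close>

lemma rtrancl_avoid_leaf:
  assumes R: "sym R" and leaf: "\<And>v w. (b, v) \<in> R \<Longrightarrow> (b, w) \<in> R \<Longrightarrow> v = w"
    and uv: "(u, v) \<in> R\<^sup>*" and ne: "u \<noteq> b" "v \<noteq> b"
  shows "(u, v) \<in> (off R {b})\<^sup>*"
proof -
  \<comment> \<open>The induction has to cover paths currently at \<open>b\<close>; for these it
    remembers the neighbour \<open>w\<close> from which \<open>b\<close> was entered.\<close>
  have "(v \<noteq> b \<longrightarrow> (u, v) \<in> (off R {b})\<^sup>*) \<and>
        (v = b \<longrightarrow> (\<exists>w. (w, b) \<in> R \<and> w \<noteq> b \<and> (u, w) \<in> (off R {b})\<^sup>*))"
    using uv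
  proof (induction rule: rtrancl_induct)
    case base
    then show ?case using ne by simp
  next
    case (step y z)
    show ?case
    proof (cases "y = b")
      case True
      then obtain w where w: "(w, b) \<in> R" "w \<noteq> b" "(u, w) \<in> (off R {b})\<^sup>*"
        using step.IH by blast
      then have "z = w" using leaf step.hyps True R by (meson symD)
      then show ?thesis using w by blast
    next
      case False
      then show ?thesis using step
        by (auto simp: off_def intro: rtrancl.rtrancl_into_rtrancl)
    qed
  qed
  then show ?thesis using ne by blast
qed

section \<open>Counting branch points\<close>

text \<open>All vertices of the path are joined to \<open>w\<close> off \<open>x'\<close>, so none
  of them is \<open>x\<close>.\<close>

lemma off_rtrancl_other:
  assumes "(w, z) \<in> (off R {x'})\<^sup>*" "(w, x) \<notin> (off R {x'})\<^sup>*"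
  shows "(w, z) \<in> (off R {x})\<^sup>*"
  using assms(1)
proof (induction rule: rtrancl_induct)
  case (step u v)
  have "u \<noteq> x" using step assms by blast
  moreover have "v \<noteq> x" using step assms by (meson rtrancl.rtrancl_into_rtrancl)
  ultimately have "(u, v) \<in> off R {x}" using step by (simp add: off_def)
  then show ?case using step by (meson rtrancl.rtrancl_into_rtrancl)
qed simp

text \<open>After its last visit to \<open>x'\<close>, a path to \<open>z\<close> stays in the
  branch of \<open>z\<close>, which does not contain \<open>x\<close>. That tail and its first edge
  avoid \<open>x\<close>.\<close>

lemma branch_survives:
  assumes "sym R" "x \<noteq> x'" "(x', z) \<in> R\<^sup>*" "z \<noteq> x'" "(z, x) \<notin> (off R {x'})\<^sup>*"
  shows "(x', z) \<in> (off R {x})\<^sup>*"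
proof -
  obtain y where y: "(x', y) \<in> R" "y \<noteq> x'" "(y, z) \<in> (off R {x'})\<^sup>*"
    using last_exit[OF assms(3), of "{x'}"] assms(4) by auto
  have "(z, y) \<in> (off R {x'})\<^sup>*" using sym_rtranclD[OF sym_off[OF assms(1)] y(3)] .
  then have ny: "(y, x) \<notin> (off R {x'})\<^sup>*" using assms(5) by (meson rtrancl_trans)
  then have "y \<noteq> x" by auto
  then have "(x', y) \<in> off R {x}" using y assms by (simp add: off_def)
  then show ?thesis using off_rtrancl_other[OF y(3) ny] by (rule converse_rtrancl_into_rtrancl)
qed

text \<open>A finite substitute for a trifurcation: infinite branches are replaced by branches that
  reach a prescribed set \<open>Y\<close> of exits.\<close>

definition branch_point :: "('a \<times> 'a) set \<Rightarrow> 'a set \<Rightarrow> 'a \<Rightarrow> bool" where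
  "branch_point R Y x \<longleftrightarrow> (\<exists>A\<subseteq>Y - {x}. card A = 3 \<and> (\<forall>a\<in>A. (x, a) \<in> R\<^sup>*) \<and>
     (\<forall>a\<in>A. \<forall>b\<in>A. a \<noteq> b \<longrightarrow> (a, b) \<notin> (off R {x})\<^sup>*))"

lemma branch_pointE:
  assumes "branch_point R Y x"
  obtains A where "A \<subseteq> Y - {x}" "card A = 3" "\<forall>a\<in>A. (x, a) \<in> R\<^sup>*"
    "\<forall>a\<in>A. \<forall>b\<in>A. a \<noteq> b \<longrightarrow> (a, b) \<notin> (off R {x})\<^sup>*"
  using assms by (auto simp: branch_point_def)

text \<open>Each predicate excludes at most one of three elements. In the applications a predicate
  says that a branch contains a given vertex.\<close>

lemma card3_avoid2:
  assumes "card A = 3" and P: "\<And>a b. a \<in> A \<Longrightarrow> b \<in> A \<Longrightarrow> P a \<Longrightarrow> P b \<Longrightarrow> a = b"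
    and Q: "\<And>a b. a \<in> A \<Longrightarrow> b \<in> A \<Longrightarrow> Q a \<Longrightarrow> Q b \<Longrightarrow> a = b"
  obtains a where "a \<in> A" "\<not> P a" "\<not> Q a"
proof -
  obtain a b c where "A = {a, b, c}" "a \<noteq> b" "b \<noteq> c" "a \<noteq> c"
    using assms(1) by (auto simp: card_3_iff)
  then have "\<exists>a\<in>A. \<not> P a \<and> \<not> Q a"
    using P Q by (smt (verit) insertCI)
  then show ?thesis using that by blast
qed

text \<open>The induction removes a branch point together with one exit point on a branch that
  contains no further branch point.\<close>

lemma card_branch_points_le:
  assumes R: "sym R" and "finite T" "finite Y" "\<And>x. x \<in> T \<Longrightarrow> branch_point R Y x"
  shows "card T \<le> card Y"
  using assms(2-)
proof (induction "card T" arbitrary: T Y)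
  case 0
  then show ?case by simp
next
  case (Suc n)
  note bp = Suc.prems(3)
  have symo: "sym ((off R {x})\<^sup>*)" for x using R by (simp add: sym_off sym_rtrancl)
  have unique: "a = b" if "(a, z) \<in> (off R {x})\<^sup>*" "(b, z) \<in> (off R {x})\<^sup>*"
    "a \<in> A" "b \<in> A" "\<forall>a\<in>A. \<forall>b\<in>A. a \<noteq> b \<longrightarrow> (a, b) \<notin> (off R {x})\<^sup>*" for a b z x A
    using that symo[of x] by (meson rtrancl_trans symD)
  define br where "br x y = (off R {x})\<^sup>* `` {y}" for x y
  define K where "K = {(x, y). x \<in> T \<and> y \<in> Y - {x} \<and> (x, y) \<in> R\<^sup>*}"
  have finT: "finite (S \<inter> T)" for S using Suc.prems by blast
  have "K \<noteq> {}"
  proof -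
    obtain x where x: "x \<in> T" using Suc.hyps Suc.prems by fastforce
    then obtain A where "A \<subseteq> Y - {x}" "card A = 3" "\<forall>a\<in>A. (x, a) \<in> R\<^sup>*"
      using branch_pointE[OF bp[OF x]] by metis
    moreover then obtain a where "a \<in> A" by fastforce
    ultimately show ?thesis using x by (auto simp: K_def)
  qed
  then obtain k0 where "k0 \<in> K" by blast
  \<comment> \<open>Among all branches of branch points, represented by pairs of a branch point and
    an exit, take one with the fewest branch points inside.\<close>
  obtain k where k: "k \<in> K"
    "\<And>l. l \<in> K \<Longrightarrow> card (br (fst k) (snd k) \<inter> T) \<le> card (br (fst l) (snd l) \<inter> T)"
    using ex_has_least_nat[of "\<lambda>k. k \<in> K" k0 "\<lambda>k. card (br (fst k) (snd k) \<inter> T)"] \<open>k0 \<in> K\<close> by blast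
  obtain x y where kxy: "k = (x, y)" by fastforce
  have xy: "x \<in> T" "y \<in> Y" "y \<noteq> x" "(x, y) \<in> R\<^sup>*" using k(1) by (auto simp: K_def kxy)
  have free: "br x y \<inter> T = {}"
  proof (rule ccontr)
    assume "br x y \<inter> T \<noteq> {}"
    then obtain x' where x': "x' \<in> T" "(y, x') \<in> (off R {x})\<^sup>*" by (auto simp: br_def)
    have ne: "x \<noteq> x'" using off_rtrancl_notin[OF x'(2)] xy by auto
    obtain A where A: "A \<subseteq> Y - {x'}" "card A = 3" "\<forall>a\<in>A. (x', a) \<in> R\<^sup>*"
      "\<forall>a\<in>A. \<forall>b\<in>A. a \<noteq> b \<longrightarrow> (a, b) \<notin> (off R {x'})\<^sup>*"
      by (rule branch_pointE[OF bp[OF x'(1)]])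
    \<comment> \<open>At most one branch of \<open>x'\<close> contains \<open>x\<close>. Any other
      branch lies inside the branch of \<open>x\<close> through \<open>y\<close> and misses
      \<open>x'\<close>, which contradicts minimality.\<close>
    obtain y' where y': "y' \<in> A" "(y', x) \<notin> (off R {x'})\<^sup>*"
      by (rule card3_avoid2[OF A(2), of "\<lambda>a. (a, x) \<in> (off R {x'})\<^sup>*" "\<lambda>_. False"])
        (use unique[OF _ _ _ _ A(4)] in blast)+
    have y'': "y' \<noteq> x'" "y' \<in> Y" "(x', y') \<in> R\<^sup>*" using y' A by auto
    then have "(x', y') \<in> K" using x' by (simp add: K_def)
    have "br x' y' \<subseteq> br x y"
    proof
      fix z assume "z \<in> br x' y'"
      then have z: "(y', z) \<in> (off R {x'})\<^sup>*" by (simp add: br_def)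
      have "(z, x) \<notin> (off R {x'})\<^sup>*" using z y' by (meson rtrancl_trans)
      moreover have "z \<noteq> x'" using off_rtrancl_notin[OF z] y'' by auto
      moreover have "(x', z) \<in> R\<^sup>*" using y'' z by (meson off_rtrancl_subset rtrancl_trans)
      ultimately have "(x', z) \<in> (off R {x})\<^sup>*" using branch_survives[OF R ne] by blast
      then show "z \<in> br x y" using x' by (auto simp: br_def intro: rtrancl_trans)
    qed
    moreover have "x' \<notin> br x' y'" using off_rtrancl_notin[of y' x' R "{x'}"] y'' by (auto simp: br_def)
    moreover have "x' \<in> br x y" using x' by (simp add: br_def)
    ultimately have "br x' y' \<inter> T \<subset> br x y \<inter> T" using x' by blast
    then have "card (br x' y' \<inter> T) < card (br x y \<inter> T)" by (rule psubset_card_mono[OF finT])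
    then show False using k(2)[OF \<open>(x', y') \<in> K\<close>] by (simp add: kxy)
  qed
  have "branch_point R (Y - {y}) x'" if x': "x' \<in> T - {x}" for x'
  proof -
    obtain A where A: "A \<subseteq> Y - {x'}" "card A = 3" "\<forall>a\<in>A. (x', a) \<in> R\<^sup>*"
      "\<forall>a\<in>A. \<forall>b\<in>A. a \<noteq> b \<longrightarrow> (a, b) \<notin> (off R {x'})\<^sup>*"
      using branch_pointE[OF bp[of x']] x' by blast
    show ?thesis
    proof (cases "y \<in> A")
      case False
      then have "A \<subseteq> Y - {y} - {x'}" using A by blast
      then show ?thesis using A unfolding branch_point_def by (intro exI[of _ A]) simp
    next
      case True
      obtain A' where A': "A' \<subseteq> Y - {x}" "card A' = 3" "\<forall>a\<in>A'. (x, a) \<in> R\<^sup>*"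
        "\<forall>a\<in>A'. \<forall>b\<in>A'. a \<noteq> b \<longrightarrow> (a, b) \<notin> (off R {x})\<^sup>*"
        by (rule branch_pointE[OF bp[OF xy(1)]])
      \<comment> \<open>The exit \<open>y\<close> is lost and needs a substitute: take the exit of a
        branch of \<open>x\<close> that contains neither \<open>y\<close> nor
        \<open>x'\<close>.\<close>
      obtain e where e: "e \<in> A'" "(e, y) \<notin> (off R {x})\<^sup>*" "(e, x') \<notin> (off R {x})\<^sup>*"
        by (rule card3_avoid2[OF A'(2), of "\<lambda>a. (a, y) \<in> (off R {x})\<^sup>*" "\<lambda>a. (a, x') \<in> (off R {x})\<^sup>*"])
          (use unique[OF _ _ _ _ A'(4)] in blast)+
      have e': "e \<noteq> y" "e \<noteq> x'" "e \<in> Y" "e \<noteq> x" "(x, e) \<in> R\<^sup>*" using e A' by auto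
      have 1: "(x, e) \<in> (off R {x'})\<^sup>*"
        by (rule branch_survives[OF R]) (use x' e e' in auto)
      have "x' \<notin> br x y" using free x' by blast
      then have 2: "(x, y) \<in> (off R {x'})\<^sup>*"
        by (intro branch_survives[OF R]) (use x' xy in \<open>auto simp: br_def\<close>)
      \<comment> \<open>Both exits hang on \<open>x\<close> after \<open>x'\<close> is deleted, so
        they lie in the same branch of \<open>x'\<close>, and \<open>e\<close> can stand in for
        \<open>y\<close>.\<close>
      have ye: "(y, e) \<in> (off R {x'})\<^sup>*" "(e, y) \<in> (off R {x'})\<^sup>*"
        using 1 2 symo[of x'] by (meson rtrancl_trans symD)+
      have eA: "(e, a) \<notin> (off R {x'})\<^sup>*" "(a, e) \<notin> (off R {x'})\<^sup>*" if "a \<in> A - {y}" for a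
        using that A(4) True ye by (metis DiffD1 DiffD2 rtrancl_trans singletonI)+
      then have "e \<notin> A - {y}" by blast
      define A2 where "A2 = insert e (A - {y})"
      have "card A2 = 3"
        using A(2) True \<open>e \<notin> A - {y}\<close>
        by (metis A2_def card.infinite card_insert_disjoint card.remove finite_Diff zero_neq_numeral)
      moreover have "A2 \<subseteq> Y - {y} - {x'}" using e' A by (auto simp: A2_def)
      moreover have "\<forall>a\<in>A2. (x', a) \<in> R\<^sup>*"
        using A(3) rtrancl_trans[OF _ off_rtrancl_subset[OF ye(1)], of x'] True by (auto simp: A2_def)
      moreover have "\<forall>a\<in>A2. \<forall>b\<in>A2. a \<noteq> b \<longrightarrow> (a, b) \<notin> (off R {x'})\<^sup>*"
        using eA A(4) by (auto simp: A2_def)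
      ultimately show ?thesis unfolding branch_point_def by (intro exI[of _ A2]) simp
    qed
  qed
  moreover have "n = card (T - {x})" using Suc.hyps xy by simp
  ultimately have "card (T - {x}) \<le> card (Y - {y})" using Suc.hyps(1)[of "T - {x}" "Y - {y}"] Suc.prems by blast
  then have "card T - 1 \<le> card Y - 1" using xy Suc.prems by simp
  \<comment> \<open>Needed because subtraction of natural numbers is truncated at zero.\<close>
  moreover have "card Y > 0" using xy Suc.prems by (auto simp: card_gt_0_iff)
  ultimately show ?case by simp
qed

section \<open>Graph of mutual edges, families of infinite clusters, trifurcations\<close>

definition mutual_edges :: "'a set \<Rightarrow> ('a \<Rightarrow> 'a set) \<Rightarrow> ('a \<times> 'a) set" where
  "mutual_edges V \<eta> = {(x, y). x \<in> V \<and> y \<in> V \<and> y \<in> \<eta> x \<and> x \<in> \<eta> y}"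

lemma sym_mutual_edges: "sym (mutual_edges V \<eta>)"
  by (auto simp: mutual_edges_def sym_def)

lemma mutual_edges_in_V: "mutual_edges V \<eta> \<subseteq> V \<times> V"
  by (auto simp: mutual_edges_def)

lemma off_mutual_edges_upd: "b \<in> B \<Longrightarrow> off (mutual_edges V (\<eta>(b := S))) B = off (mutual_edges V \<eta>) B"
  by (auto simp: off_def mutual_edges_def)

text \<open>One representative per cluster expresses "at least \<open>m\<close>" without counting a
  possibly infinite family; finite sets of representatives also make the event measurable.\<close>

definition many_infinite :: "('a \<times> 'a) set \<Rightarrow> nat \<Rightarrow> bool" where
  "many_infinite R m \<longleftrightarrow> (\<exists>A. finite A \<and> card A = m \<and> (\<forall>x\<in>A. infinite (R\<^sup>* `` {x})) \<and>
     (\<forall>x\<in>A. \<forall>y\<in>A. x \<noteq> y \<longrightarrow> (x, y) \<notin> R\<^sup>*))"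

lemma many_infinite_mono:
  assumes "many_infinite R m" "n \<le> m"
  shows "many_infinite R n"
proof -
  obtain A where A: "finite A" "card A = m" "\<forall>x\<in>A. infinite (R\<^sup>* `` {x})"
    "\<forall>x\<in>A. \<forall>y\<in>A. x \<noteq> y \<longrightarrow> (x, y) \<notin> R\<^sup>*"
    using assms(1) by (auto simp: many_infinite_def)
  obtain B where B: "B \<subseteq> A" "card B = n" using A assms(2) by (metis obtain_subset_with_card_n)
  have "finite B" using finite_subset[OF B(1) A(1)] .
  then show ?thesis using A(3,4) B unfolding many_infinite_def by (metis subsetD)
qed

text \<open>Only three branches are exhibited; \<open>u\<close> may have further finite or infinite
  ones. Bounding the neighbours by \<open>W\<close> later gives a quantifier over a countable
  family.\<close>

definition trifurcation :: "'a set \<Rightarrow> ('a \<times> 'a) set \<Rightarrow> 'a \<Rightarrow> bool" where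
  "trifurcation W R u \<longleftrightarrow> (\<exists>A\<subseteq>W. finite A \<and> card A = 3 \<and>
     (\<forall>a\<in>A. (u, a) \<in> R \<and> infinite ((off R {u})\<^sup>* `` {a})) \<and>
     (\<forall>a\<in>A. \<forall>b\<in>A. a \<noteq> b \<longrightarrow> (a, b) \<notin> (off R {u})\<^sup>*))"

section \<open>Connected finite vertex sets\<close>

definition connected_in :: "('a \<times> 'a) set \<Rightarrow> 'a set \<Rightarrow> bool" where
  "connected_in E B \<longleftrightarrow> finite B \<and> (\<forall>x\<in>B. \<forall>y\<in>B. (x, y) \<in> (E \<inter> B \<times> B)\<^sup>*)"

lemma connected_in_insert:
  assumes E: "sym E" and B: "connected_in E B" and cb: "c \<in> B" "(c, b) \<in> E"
  shows "connected_in E (insert b B)"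
proof -
  let ?F = "E \<inter> insert b B \<times> insert b B"
  have sub: "E \<inter> B \<times> B \<subseteq> ?F" by blast
  have F: "(c, b) \<in> ?F" "(b, c) \<in> ?F" using cb E by (auto dest: symD)
  have BB: "(x, y) \<in> ?F\<^sup>*" if "x \<in> B" "y \<in> B" for x y
    using B that rtrancl_mono[OF sub] by (auto simp: connected_in_def)
  have "(x, c) \<in> ?F\<^sup>*" "(c, x) \<in> ?F\<^sup>*" if "x \<in> insert b B" for x
    using that BB cb F by auto
  then have "(x, y) \<in> ?F\<^sup>*" if "x \<in> insert b B" "y \<in> insert b B" for x y
    using that by (meson rtrancl_trans)
  then show ?thesis using B by (simp add: connected_in_def)
qed

lemma connected_in_extend:
  assumes E: "sym E" and B: "connected_in E B" "v \<in> B" and vx: "(v, x) \<in> E\<^sup>*"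
  shows "\<exists>B'. connected_in E B' \<and> B \<subseteq> B' \<and> x \<in> B'"
  using vx
proof (induction rule: rtrancl_induct)
  case base
  then show ?case using B by blast
next
  case (step y z)
  then obtain B' where "connected_in E B'" "B \<subseteq> B'" "y \<in> B'" by blast
  then show ?case using connected_in_insert[OF E _ _ step.hyps(2)]
    by (intro exI[of _ "insert z B'"]) auto
qed

lemma connected_in_cover:
  assumes E: "sym E" and X: "finite X" "\<And>x. x \<in> X \<Longrightarrow> (v, x) \<in> E\<^sup>*"
  shows "\<exists>B. connected_in E B \<and> v \<in> B \<and> X \<subseteq> B"
  using X
proof (induction X)
  case empty
  then show ?case by (intro exI[of _ "{v}"]) (simp add: connected_in_def)
next
  case (insert x X)
  then obtain B where "connected_in E B" "v \<in> B" "X \<subseteq> B" by blast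
  then show ?case using connected_in_extend[OF E, of B v x] insert.prems by auto
qed

text \<open>A maximal proper connected subset \<open>K\<close> containing \<open>v\<close> has an
  edge into the rest of \<open>B\<close>. Adding its end keeps connectedness, so by maximality this
  fills \<open>B\<close>.\<close>

lemma connected_in_non_cut_vertex:
  assumes E: "sym E" and B: "connected_in E B" "v \<in> B" "B \<noteq> {v}"
  obtains b c K where "B = insert b K" "b \<notin> K" "c \<in> K" "(c, b) \<in> E" "b \<noteq> v" "connected_in E K"
proof -
  define \<K> where "\<K> = {K. connected_in E K \<and> v \<in> K \<and> K \<subset> B}"
  have "\<K> \<subseteq> Pow B" by (auto simp: \<K>_def)
  moreover have "finite (Pow B)" using B by (simp add: connected_in_def)
  ultimately have "finite \<K>" by (rule finite_subset)
  moreover have "{v} \<in> \<K>" using B by (auto simp: \<K>_def connected_in_def)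
  ultimately obtain K where K: "K \<in> \<K>" and max: "\<And>L. L \<in> \<K> \<Longrightarrow> K \<subseteq> L \<Longrightarrow> K = L"
    using finite_has_maximal2[of \<K> "{v}"] by blast
  then obtain z where z: "z \<in> B" "z \<notin> K" by (auto simp: \<K>_def)
  have vz: "(v, z) \<in> (E \<inter> B \<times> B)\<^sup>*" using B z by (simp add: connected_in_def)
  obtain c b where cb: "c \<in> K" "(c, b) \<in> E \<inter> B \<times> B" "b \<notin> K"
    by (rule last_exit[OF vz, of K]) (use K z in \<open>auto simp: \<K>_def\<close>)
  have conn: "connected_in E (insert b K)"
    using connected_in_insert[OF E, of K c b] K cb by (auto simp: \<K>_def)
  have "insert b K = B"
  proof (rule ccontr)
    assume "insert b K \<noteq> B"
    then have "insert b K \<in> \<K>" using conn cb K by (auto simp: \<K>_def)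
    then show False using max cb by blast
  qed
  then show ?thesis using that[of b K c] cb K by (auto simp: \<K>_def)
qed

section \<open>Rewiring a finite set of vertices\<close>

locale rewiring =
  fixes V :: "'a set" and E :: "('a \<times> 'a) set" and d :: nat and p :: "nat \<Rightarrow> real"
  assumes E_subset: "E \<subseteq> V \<times> V - Id"
    and sym_E: "sym E"
    and regular: "regular_graph V E d"
    and conn_E: "connected_graph V E"
    and p01: "p 0 + p 1 > 0"
    and p2: "p 2 > 0"
    and p3: "(\<Sum>i=3..d. p i) > 0"
begin

abbreviation "\<Omega> \<equiv> Pi\<^sub>E V (\<lambda>x. Pow (nbrs E x))"

definition admissible :: "'a \<Rightarrow> 'a set \<Rightarrow> bool" where
  "admissible x S \<longleftrightarrow> x \<in> V \<and> S \<subseteq> nbrs E x \<and> p (card S) > 0"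

text \<open>Such a family turns almost sure statements into pointwise ones: the rewiring arguments
  stay inside \<open>\<G>\<close> and need no measurability.\<close>

definition closed_under_upd :: "('a \<Rightarrow> 'a set) set \<Rightarrow> bool" where
  "closed_under_upd \<G> \<longleftrightarrow> \<G> \<subseteq> \<Omega> \<and> (\<forall>\<eta>\<in>\<G>. \<forall>x S. admissible x S \<longrightarrow> \<eta>(x := S) \<in> \<G>)"

lemma finite_nbrs: "x \<in> V \<Longrightarrow> finite (nbrs E x)" and card_nbrs: "x \<in> V \<Longrightarrow> card (nbrs E x) = d"
  using regular by (auto simp: regular_graph_def)

lemma E_in_V: "(x, y) \<in> E \<Longrightarrow> x \<in> V \<and> y \<in> V \<and> x \<noteq> y"
  using E_subset by auto

lemma state_subset: "\<eta> \<in> \<Omega> \<Longrightarrow> x \<in> V \<Longrightarrow> y \<in> \<eta> x \<Longrightarrow> (x, y) \<in> E"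
  by (auto simp: nbrs_def dest!: PiE_mem)

lemma mutual_edges_subset: "\<eta> \<in> \<Omega> \<Longrightarrow> mutual_edges V \<eta> \<subseteq> E"
  by (auto simp: mutual_edges_def intro: state_subset)

lemma locally_finite:
  assumes "\<eta> \<in> \<Omega>" shows "finite (mutual_edges V \<eta> `` {v})"
proof (cases "v \<in> V")
  case True
  have "mutual_edges V \<eta> `` {v} \<subseteq> nbrs E v" using mutual_edges_subset[OF assms] by (auto simp: nbrs_def)
  then show ?thesis using finite_nbrs[OF True] finite_subset by blast
next
  case False
  then have "mutual_edges V \<eta> `` {v} = {}" by (auto simp: mutual_edges_def)
  then show ?thesis by simp
qed

text \<open>Otherwise the sum in \<open>p3\<close> is empty.\<close>

lemma d_ge_3: "d \<ge> 3"
  using p3 by (cases "d \<ge> 3") auto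

lemma small_state:
  assumes "x \<in> V"
  shows "\<exists>S. admissible x S \<and> (\<forall>v\<in>S. \<forall>w\<in>S. v = w)"
proof (cases "p 0 > 0")
  case True
  then show ?thesis using assms by (intro exI[of _ "{}"]) (auto simp: admissible_def)
next
  case False
  then have "p 1 > 0" using p01 by simp
  moreover obtain v where "v \<in> nbrs E x" using card_nbrs[OF assms] d_ge_3 by fastforce
  ultimately show ?thesis using assms by (intro exI[of _ "{v}"]) (auto simp: admissible_def)
qed

text \<open>Some size \<open>j\<close> between 3 and \<open>d\<close> has positive weight, and
  \<open>A\<close> can be enlarged to \<open>j\<close> of the \<open>d\<close> neighbours.\<close>

lemma large_state:
  assumes "x \<in> V" "A \<subseteq> nbrs E x" "card A = 3"
  obtains S where "admissible x S" "A \<subseteq> S"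
proof -
  obtain j where j: "j \<in> {3..d}" "p j > 0"
    using p3 by (meson not_le sum_nonpos)
  obtain T where "A \<subseteq> T" "T \<subseteq> nbrs E x" "card T = j"
    using exists_subset_between[of A j "nbrs E x"] assms j card_nbrs finite_nbrs by auto
  then show ?thesis using that[of T] assms j by (auto simp: admissible_def)
qed

lemma \<Omega>_upd: "\<eta> \<in> \<Omega> \<Longrightarrow> admissible x S \<Longrightarrow> \<eta>(x := S) \<in> \<Omega>"
  by (auto simp: admissible_def PiE_iff extensional_def)

text \<open>The edge from \<open>y i\<close> to \<open>\<beta> i\<close> is only required to be open at its outer end, because the states inside
  \<open>B\<close> are going to be replaced.\<close>

definition spider :: "('a \<Rightarrow> 'a set) \<Rightarrow> 'a set \<Rightarrow> 'i set \<Rightarrow> ('i \<Rightarrow> 'a) \<Rightarrow> ('i \<Rightarrow> 'a) \<Rightarrow> bool" where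
  "spider \<eta> B I \<beta> y \<longleftrightarrow>
     (\<forall>i\<in>I. \<beta> i \<in> B \<and> y i \<in> V - B \<and> \<beta> i \<in> \<eta> (y i) \<and> infinite ((off (mutual_edges V \<eta>) B)\<^sup>* `` {y i})) \<and>
     (\<forall>i\<in>I. \<forall>j\<in>I. i \<noteq> j \<longrightarrow> (y i, y j) \<notin> (off (mutual_edges V \<eta>) B)\<^sup>*)"

text \<open>If no leg ends at \<open>b\<close>, a small state makes \<open>b\<close> a leaf and
  joins nothing. If one leg ends there, \<open>b\<close> is appended to its branch and the leg now
  ends at \<open>c\<close>. Two legs at \<open>b\<close> would be merged, hence the hypothesis
  \<open>one\<close>.\<close>

lemma spider_step:
  assumes \<eta>: "\<eta> \<in> \<Omega>" and sp: "spider \<eta> (insert b K) I \<beta> y"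
    and b: "b \<notin> K" "c \<in> K" "(c, b) \<in> E"
    and one: "\<And>i j. i \<in> I \<Longrightarrow> j \<in> I \<Longrightarrow> \<beta> i = b \<Longrightarrow> \<beta> j = b \<Longrightarrow> i = j"
  shows "\<exists>S \<beta>' y'. admissible b S \<and> spider (\<eta>(b := S)) K I \<beta>' y'"
proof -
  have bV: "b \<in> V" "c \<in> V" "b \<noteq> c" using b E_in_V by auto
  let ?R = "mutual_edges V \<eta>"
  \<comment> \<open>The graph off \<open>K\<close> once \<open>b\<close> is back with state
    \<open>S\<close>; deleting \<open>b\<close> again recovers the old graph, whatever
    \<open>S\<close> is.\<close>
  define Q where "Q S = off (mutual_edges V (\<eta>(b := S))) K" for S
  have symQ: "sym (Q S)" for S by (simp add: Q_def sym_off sym_mutual_edges)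
  have offQ: "off (Q S) {b} = off ?R (insert b K)" for S
    unfolding Q_def off_off using off_mutual_edges_upd[of b "insert b K"] by simp
  have edge: "(b, v) \<in> Q S \<longleftrightarrow> v \<in> V \<and> v \<notin> K \<and> v \<in> S \<and> b \<in> \<eta> v" if "admissible b S" for v S
    using that bV b E_in_V by (auto simp: Q_def off_def mutual_edges_def admissible_def nbrs_def)
  have sub: "(off ?R (insert b K))\<^sup>* \<subseteq> (Q S)\<^sup>*" for S
    using rtrancl_mono[OF off_subset[of "Q S" "{b}"]] by (simp add: offQ)
  have inf: "infinite ((Q S)\<^sup>* `` {y i})" if "i \<in> I" for i S
    using that sp Image_mono[OF sub] by (meson finite_subset order_refl spider_def)
  have y: "y i \<in> V" "y i \<notin> K" "y i \<noteq> b" "\<beta> i \<in> insert b K" "\<beta> i \<in> \<eta> (y i)" if "i \<in> I" for i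
    using sp that by (auto simp: spider_def)
  have sep: "(y i, y j) \<notin> (Q S)\<^sup>*" if "i \<in> I" "j \<in> I" "i \<noteq> j"
    "\<And>v w. (b, v) \<in> Q S \<Longrightarrow> (b, w) \<in> Q S \<Longrightarrow> v = w" for i j S
  proof
    assume "(y i, y j) \<in> (Q S)\<^sup>*"
    then have "(y i, y j) \<in> (off (Q S) {b})\<^sup>*"
      using rtrancl_avoid_leaf[OF symQ, of b S "y i" "y j"] that(4) y(3)[OF that(1)] y(3)[OF that(2)]
      by blast
    then show False using sp that by (auto simp: offQ spider_def)
  qed
  show ?thesis
  proof (cases "\<exists>i\<in>I. \<beta> i = b")
    case False
    obtain S where S: "admissible b S" "\<forall>v\<in>S. \<forall>w\<in>S. v = w"
      using small_state[OF bV(1)] by blast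
    have leaf: "v = w" if "(b, v) \<in> Q S" "(b, w) \<in> Q S" for v w
      using that edge[OF S(1)] S(2) by blast
    have "(y i, y j) \<notin> (Q S)\<^sup>*" if "i \<in> I" "j \<in> I" "i \<noteq> j" for i j
      using sep[of i j S] that leaf by blast
    then have "spider (\<eta>(b := S)) K I \<beta> y"
      unfolding spider_def Q_def[symmetric]
      using False y inf by auto
    then show ?thesis using S by blast
  next
    case True
    then obtain i0 where i0: "i0 \<in> I" "\<beta> i0 = b" by blast
    \<comment> \<open>One element links \<open>b\<close> to the branch, the other points into
      \<open>K\<close>. As \<open>K\<close> is still deleted, \<open>b\<close> is a leaf of
      \<open>Q S\<close> and cannot join branches.\<close>
    define S where "S = {y i0, c}"
    have "(y i0, b) \<in> E" using state_subset[OF \<eta>] y[OF i0(1)] i0 by auto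
    then have "S \<subseteq> nbrs E b" using b sym_E by (auto simp: S_def nbrs_def dest: symD)
    moreover have "card S = 2" using y(2)[OF i0(1)] b(2) by (auto simp: S_def card_insert_if)
    ultimately have S: "admissible b S" using bV p2 by (simp add: admissible_def)
    have leaf: "v = y i0" if "(b, v) \<in> Q S" for v
      using that edge[OF S] b by (auto simp: S_def)
    have by0: "(b, y i0) \<in> Q S" using edge[OF S] y[OF i0(1)] i0 by (auto simp: S_def)
    have "infinite ((Q S)\<^sup>* `` {b})"
    proof -
      have "(Q S)\<^sup>* `` {y i0} \<subseteq> (Q S)\<^sup>* `` {b}" using converse_rtrancl_into_rtrancl[OF by0] by blast
      then show ?thesis using inf[OF i0(1), of S] finite_subset by blast
    qed
    then have 1: "(\<beta>(i0 := c)) i \<in> K \<and> (y(i0 := b)) i \<in> V - K \<and>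
        (\<beta>(i0 := c)) i \<in> (\<eta>(b := S)) ((y(i0 := b)) i) \<and> infinite ((Q S)\<^sup>* `` {(y(i0 := b)) i})"
      if "i \<in> I" for i
      using y[OF that] inf[OF that, of S] one[OF that i0(1)] i0 b bV
      by (cases "i = i0") (auto simp: S_def)
    have yb: "(b, y j) \<notin> (Q S)\<^sup>*" "(y j, b) \<notin> (Q S)\<^sup>*" if "j \<in> I" "j \<noteq> i0" for j
    proof -
      have "(y i0, b) \<in> Q S" using by0 symQ by (meson symD)
      note converse_rtrancl_into_rtrancl[OF this, of "y j"]
      moreover have "(y i0, y j) \<notin> (Q S)\<^sup>*" using sep[of i0 j S] that i0 leaf by blast
      ultimately show "(b, y j) \<notin> (Q S)\<^sup>*" by blast
      then show "(y j, b) \<notin> (Q S)\<^sup>*" using sym_rtranclD[OF symQ] by blast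
    qed
    have yy: "(y i, y j) \<notin> (Q S)\<^sup>*" if "i \<in> I" "j \<in> I" "i \<noteq> j" for i j
      using sep[of i j S] that leaf by blast
    have 2: "((y(i0 := b)) i, (y(i0 := b)) j) \<notin> (Q S)\<^sup>*" if "i \<in> I" "j \<in> I" "i \<noteq> j" for i j
      using yy[OF that] yb[of i] yb[of j] that by auto
    have "spider (\<eta>(b := S)) K I (\<beta>(i0 := c)) (y(i0 := b))"
      unfolding spider_def Q_def[symmetric] using 1 2 by blast
    then show ?thesis using S by blast
  qed
qed

text \<open>Induction on the size of \<open>B\<close>, each time removing a non-cut vertex at which
  at most one leg ends. With at most three legs, several can meet at only one vertex
  \<open>v\<close>, chosen afresh at every stage and spared.\<close>

lemma spider_shrink:
  fixes I :: "'i set"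
  assumes \<G>: "closed_under_upd \<G>" and I: "finite I" "card I \<le> 3" "I \<noteq> {}"
    and "\<eta> \<in> \<G>" "connected_in E B" "spider \<eta> B I \<beta> y"
  shows "\<exists>\<eta>'\<in>\<G>. \<exists>u \<beta>' y'. spider \<eta>' {u} I \<beta>' y'"
  using assms(5-)
proof (induction "card B" arbitrary: B \<eta> \<beta> y rule: less_induct)
  case less
  have B: "finite B" "\<And>i. i \<in> I \<Longrightarrow> \<beta> i \<in> B"
    using less.prems by (auto simp: connected_in_def spider_def)
  obtain v where v: "v \<in> B" "\<And>b i j. b \<noteq> v \<Longrightarrow> i \<in> I \<Longrightarrow> j \<in> I \<Longrightarrow> \<beta> i = b \<Longrightarrow> \<beta> j = b \<Longrightarrow> i = j"
  proof (cases "inj_on \<beta> I")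
    case True
    then show ?thesis using that B I by (metis all_not_in_conv inj_onD)
  next
    case False
    then obtain i j where ij: "i \<in> I" "j \<in> I" "i \<noteq> j" "\<beta> i = \<beta> j" by (auto simp: inj_on_def)
    \<comment> \<open>A second meeting vertex would need two further indices, four in all.\<close>
    have "k = l" if "b \<noteq> \<beta> i" "k \<in> I" "l \<in> I" "\<beta> k = b" "\<beta> l = b" for b k l
    proof (rule ccontr)
      assume "k \<noteq> l"
      moreover have "i \<noteq> k" "i \<noteq> l" "j \<noteq> k" "j \<noteq> l" using that ij by auto
      ultimately have "card {i, j, k, l} = 4" using ij by simp
      moreover have "card {i, j, k, l} \<le> card I" using I ij that by (intro card_mono) auto
      ultimately show False using I by simp
    qed
    then show ?thesis using that[of "\<beta> i"] B ij by blast
  qed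
  show ?case
  proof (cases "B = {v}")
    case True
    then show ?thesis using less.prems by blast
  next
    case False
    obtain b c K where b: "B = insert b K" "b \<notin> K" "c \<in> K" "(c, b) \<in> E" "b \<noteq> v" "connected_in E K"
      using connected_in_non_cut_vertex[OF sym_E less.prems(2) v(1) False] .
    have \<eta>: "\<eta> \<in> \<Omega>" using less.prems \<G> by (auto simp: closed_under_upd_def)
    have sp: "spider \<eta> (insert b K) I \<beta> y" using less.prems(3) b(1) by simp
    have "\<exists>S \<beta>' y'. admissible b S \<and> spider (\<eta>(b := S)) K I \<beta>' y'"
      by (rule spider_step[OF \<eta> sp b(2-4)]) (use v(2)[OF b(5)] in blast)
    then obtain S \<beta>' y' where S: "admissible b S" "spider (\<eta>(b := S)) K I \<beta>' y'" by blast
    have "\<eta>(b := S) \<in> \<G>" using \<G> less.prems S by (auto simp: closed_under_upd_def)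
    moreover have "card K < card B" using b B by simp
    ultimately show ?thesis using less.hyps b(6) S(2) by blast
  qed
qed

section \<open>Infinite branches around a single vertex\<close>

text \<open>A spider with body \<open>{u}\<close>, recorded by its outer ends. No condition is put
  on the state of \<open>u\<close>, which can still be chosen freely.\<close>

definition hub :: "('a \<Rightarrow> 'a set) \<Rightarrow> 'a \<Rightarrow> 'a set \<Rightarrow> bool" where
  "hub \<eta> u A \<longleftrightarrow> u \<in> V \<and> A \<subseteq> nbrs E u \<and>
     (\<forall>a\<in>A. u \<in> \<eta> a \<and> infinite ((off (mutual_edges V \<eta>) {u})\<^sup>* `` {a})) \<and>
     (\<forall>a\<in>A. \<forall>b\<in>A. a \<noteq> b \<longrightarrow> (a, b) \<notin> (off (mutual_edges V \<eta>) {u})\<^sup>*)"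

text \<open>Enclose the representatives in a finite connected \<open>B\<close>. Each cluster leaves
  \<open>B\<close> along an infinite branch, and branches of different clusters are separated, so
  they form a spider that can be shrunk to one vertex.\<close>

lemma ex_hub:
  assumes \<G>: "closed_under_upd \<G>" and \<eta>: "\<eta> \<in> \<G>"
    and many: "many_infinite (mutual_edges V \<eta>) m" and m: "0 < m" "m \<le> 3"
  shows "\<exists>\<eta>'\<in>\<G>. \<exists>u A. card A = m \<and> hub \<eta>' u A"
proof -
  let ?R = "mutual_edges V \<eta>"
  have \<eta>': "\<eta> \<in> \<Omega>" using \<eta> \<G> by (auto simp: closed_under_upd_def)
  obtain I where I: "finite I" "card I = m" "\<forall>x\<in>I. infinite (?R\<^sup>* `` {x})"
    "\<forall>x\<in>I. \<forall>y\<in>I. x \<noteq> y \<longrightarrow> (x, y) \<notin> ?R\<^sup>*"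
    using many by (auto simp: many_infinite_def)
  have IV: "I \<subseteq> V"
  proof
    fix x assume "x \<in> I"
    then have "infinite (?R\<^sup>* `` {x})" using I(3) by blast
    then show "x \<in> V" by (rule infinite_cluster_in_carrier[OF _ mutual_edges_in_V])
  qed
  obtain v where v: "v \<in> I" using I m by fastforce
  then have "(v, x) \<in> E\<^sup>*" if "x \<in> I" for x using conn_E that IV by (auto simp: connected_graph_def)
  then obtain B where B: "connected_in E B" "I \<subseteq> B" using connected_in_cover[OF sym_E I(1)] by blast
  have finB: "finite B" using B by (simp add: connected_in_def)
  have "\<exists>b y. (x, b) \<in> ?R\<^sup>* \<and> b \<in> B \<and> (b, y) \<in> ?R \<and> y \<notin> B \<and> infinite ((off ?R B)\<^sup>* `` {y})"
    if "x \<in> I" for x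
  proof -
    have inf: "infinite (?R\<^sup>* `` {x})" and "x \<in> B" using I B that by auto
    then show ?thesis by (rule infinite_branch[OF locally_finite[OF \<eta>'] finB]) blast
  qed
  then obtain \<beta> y where \<beta>: "\<And>x. x \<in> I \<Longrightarrow> (x, \<beta> x) \<in> ?R\<^sup>*" "\<And>x. x \<in> I \<Longrightarrow> \<beta> x \<in> B"
    "\<And>x. x \<in> I \<Longrightarrow> (\<beta> x, y x) \<in> ?R" "\<And>x. x \<in> I \<Longrightarrow> y x \<notin> B"
    "\<And>x. x \<in> I \<Longrightarrow> infinite ((off ?R B)\<^sup>* `` {y x})"
    by metis
  have "(y i, y j) \<notin> (off ?R B)\<^sup>*" if "i \<in> I" "j \<in> I" "i \<noteq> j" for i j
  proof
    assume "(y i, y j) \<in> (off ?R B)\<^sup>*"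
    then have "(y i, y j) \<in> ?R\<^sup>*" by (rule off_rtrancl_subset)
    moreover have "(i, y i) \<in> ?R\<^sup>*" "(j, y j) \<in> ?R\<^sup>*"
      using \<beta>(1,3) that by (meson rtrancl.rtrancl_into_rtrancl)+
    ultimately have "(i, j) \<in> ?R\<^sup>*"
      using sym_rtranclD[OF sym_mutual_edges] by (meson rtrancl_trans)
    then show False using I that by blast
  qed
  moreover have "y i \<in> V" "\<beta> i \<in> \<eta> (y i)" if "i \<in> I" for i
    using \<beta>(3)[OF that] by (auto simp: mutual_edges_def)
  ultimately have "spider \<eta> B I \<beta> y" using \<beta> by (simp add: spider_def)
  then obtain \<eta>' u \<beta>' y' where sp: "\<eta>' \<in> \<G>" "spider \<eta>' {u} I \<beta>' y'"
    using spider_shrink[OF \<G> I(1) _ _ \<eta> B(1), of \<beta> y] I(2) m v by blast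
  have "\<eta>' \<in> \<Omega>" using sp \<G> by (auto simp: closed_under_upd_def)
  then have yE: "(y' i, u) \<in> E" "(u, y' i) \<in> E" "u \<in> \<eta>' (y' i)" if "i \<in> I" for i
  proof -
    show 1: "u \<in> \<eta>' (y' i)" using sp that by (auto simp: spider_def)
    have "y' i \<in> V" using sp that by (auto simp: spider_def)
    with \<open>\<eta>' \<in> \<Omega>\<close> show "(y' i, u) \<in> E" using state_subset 1 by blast
    then show "(u, y' i) \<in> E" using sym_E by (meson symD)
  qed
  have inj: "inj_on y' I" using sp unfolding spider_def inj_on_def by (metis rtrancl.rtrancl_refl)
  have "hub \<eta>' u (y' ` I)"
    using sp yE E_in_V[OF yE(1)[OF v]] unfolding hub_def spider_def by (auto simp: nbrs_def)
  moreover have "card (y' ` I) = m" using inj I by (simp add: card_image)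
  ultimately show ?thesis using sp by blast
qed

lemma ex_trifurcation:
  assumes \<G>: "closed_under_upd \<G>" and \<eta>: "\<eta> \<in> \<G>" and many: "many_infinite (mutual_edges V \<eta>) 3"
  shows "\<exists>\<eta>'\<in>\<G>. \<exists>u\<in>V. trifurcation V (mutual_edges V \<eta>') u"
proof -
  obtain \<eta>1 u A where A: "\<eta>1 \<in> \<G>" "card A = 3" "hub \<eta>1 u A"
    using ex_hub[OF \<G> \<eta> many] by auto
  then have u: "u \<in> V" "A \<subseteq> nbrs E u" by (auto simp: hub_def)
  \<comment> \<open>Extra elements of \<open>S\<close> are harmless, since a trifurcation is tested
    after deleting \<open>u\<close>.\<close>
  obtain S where S: "admissible u S" "A \<subseteq> S" by (rule large_state[OF u A(2)])
  let ?w = "\<eta>1(u := S)"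
  have "off (mutual_edges V ?w) {u} = off (mutual_edges V \<eta>1) {u}" by (simp add: off_mutual_edges_upd)
  moreover have "(u, a) \<in> mutual_edges V ?w" if "a \<in> A" for a
    using that A(3) S u E_in_V by (fastforce simp: mutual_edges_def hub_def nbrs_def)
  moreover have "A \<subseteq> V" using u E_in_V by (auto simp: nbrs_def)
  moreover have "finite A" using A(2) by (metis card.infinite zero_neq_numeral)
  ultimately have "trifurcation V (mutual_edges V ?w) u"
    using A unfolding trifurcation_def hub_def by (intro exI[of _ A]) auto
  moreover have "?w \<in> \<G>" using A \<G> S by (auto simp: closed_under_upd_def)
  ultimately show ?thesis using u by blast
qed

text \<open>At a hub with two branches, a state of size at most one keeps the branches apart while a state
  of size two joins them; the remaining infinite clusters are the same in both cases.\<close>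

lemma no_constant_finite_number:
  assumes \<G>: "closed_under_upd \<G>" "\<G> \<noteq> {}" and k: "k \<ge> 2"
    and const: "\<And>\<eta>. \<eta> \<in> \<G> \<Longrightarrow> many_infinite (mutual_edges V \<eta>) k \<and> \<not> many_infinite (mutual_edges V \<eta>) (Suc k)"
  shows False
proof -
  obtain \<eta> where \<eta>: "\<eta> \<in> \<G>" using \<G> by blast
  then have "many_infinite (mutual_edges V \<eta>) 2" using const many_infinite_mono[OF _ k] by blast
  then obtain \<eta>1 u Y where Y: "\<eta>1 \<in> \<G>" "card Y = 2" "hub \<eta>1 u Y"
    using ex_hub[OF \<G>(1) \<eta>, of 2] by auto
  then obtain y1 y2 where y12: "Y = {y1, y2}" "y1 \<noteq> y2" by (auto simp: card_2_iff)
  have u: "u \<in> V" "Y \<subseteq> nbrs E u" using Y by (auto simp: hub_def)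
  obtain S1 where S1: "admissible u S1" "\<forall>v\<in>S1. \<forall>w\<in>S1. v = w"
    using small_state[OF u(1)] by blast
  have S2: "admissible u Y" using u Y(2) p2 by (simp add: admissible_def)
  define R1 where "R1 = mutual_edges V (\<eta>1(u := S1))"
  define R2 where "R2 = mutual_edges V (\<eta>1(u := Y))"
  have G1: "\<eta>1(u := S1) \<in> \<G>" and G2: "\<eta>1(u := Y) \<in> \<G>"
    using \<G> Y S1 S2 by (auto simp: closed_under_upd_def)
  then have w2: "\<eta>1(u := Y) \<in> \<Omega>" using \<G> by (auto simp: closed_under_upd_def)
  define O' where "O' = off (mutual_edges V \<eta>1) {u}"
  have O1: "off R1 {u} = O'" and O2: "off R2 {u} = O'"
    by (auto simp: R1_def R2_def O'_def off_mutual_edges_upd)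
  have sub1: "O'\<^sup>* \<subseteq> R1\<^sup>*" and sub2: "O'\<^sup>* \<subseteq> R2\<^sup>*"
    using O1 O2 off_subset rtrancl_mono by metis+
  have leaf: "v = w" if "(u, v) \<in> R1" "(u, w) \<in> R1" for v w
    using that S1(2) by (auto simp: R1_def mutual_edges_def split: if_splits)
  have sep1: "(v, w) \<in> O'\<^sup>*" if "(v, w) \<in> R1\<^sup>*" "v \<noteq> u" "w \<noteq> u" for v w
    using rtrancl_avoid_leaf[of R1 u v w] leaf that O1 by (auto simp: R1_def sym_mutual_edges)
  have sym2: "(w, v) \<in> R2\<^sup>*" if "(v, w) \<in> R2\<^sup>*" for v w
    using that sym_rtranclD sym_mutual_edges unfolding R2_def by metis
  have yy: "y \<noteq> u" "infinite (O'\<^sup>* `` {y})" "(u, y) \<in> R2" if "y \<in> Y" for y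
    using that Y(3) u E_in_V by (fastforce simp: hub_def nbrs_def O'_def R2_def mutual_edges_def)+
  have y12_O: "(y1, y2) \<notin> O'\<^sup>*" "(y2, y1) \<notin> O'\<^sup>*" using Y(3) y12 by (auto simp: hub_def O'_def)
  have y12_2: "(y1, y2) \<in> R2\<^sup>*"
    using yy(3)[of y1] yy(3)[of y2] y12 sym2 by (meson insertCI r_into_rtrancl rtrancl_trans)
  obtain A where A: "finite A" "card A = k" "\<forall>x\<in>A. infinite (R2\<^sup>* `` {x})"
    "\<forall>x\<in>A. \<forall>y\<in>A. x \<noteq> y \<longrightarrow> (x, y) \<notin> R2\<^sup>*"
    using const[OF G2] by (auto simp: many_infinite_def R2_def)
  \<comment> \<open>A representative may be \<open>u\<close> itself or lie in a finite piece left by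
    its deletion, so it is moved within its cluster to an infinite piece.\<close>
  have "\<exists>y. (x, y) \<in> R2\<^sup>* \<and> y \<noteq> u \<and> infinite (O'\<^sup>* `` {y})" if "x \<in> A" for x
  proof -
    have inf: "infinite ((mutual_edges V (\<eta>1(u := Y)))\<^sup>* `` {x})" using A(3) that by (simp add: R2_def)
    show ?thesis
      by (rule infinite_cluster_off[OF locally_finite[OF w2] _ sym_mutual_edges inf, where B = "{u}"])
        (use O2 in \<open>auto simp: R2_def\<close>)
  qed
  then obtain f where f: "\<And>x. x \<in> A \<Longrightarrow> (x, f x) \<in> R2\<^sup>*" "\<And>x. x \<in> A \<Longrightarrow> f x \<noteq> u"
    "\<And>x. x \<in> A \<Longrightarrow> infinite (O'\<^sup>* `` {f x})" by metis
  \<comment> \<open>Discard the cluster in which \<open>R2\<close> joins \<open>y1\<close> and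
    \<open>y2\<close>; this costs at most one representative.\<close>
  define A0 where "A0 = {a \<in> A. (a, y1) \<notin> R2\<^sup>*}"
  have fsep: "(f a, f b) \<notin> R2\<^sup>*" if "a \<in> A" "b \<in> A" "a \<noteq> b" for a b
    using A(4) that f(1) sym2 by (meson rtrancl_trans)
  have ysep: "(f a, y) \<notin> R2\<^sup>*" "(y, f a) \<notin> R2\<^sup>*" if "a \<in> A0" "y \<in> Y" for a y
  proof -
    have "(y, y1) \<in> R2\<^sup>*" using that y12 y12_2 sym2 by auto
    moreover have "(a, f a) \<in> R2\<^sup>*" "(a, y1) \<notin> R2\<^sup>*" using that f(1) by (auto simp: A0_def)
    ultimately show "(f a, y) \<notin> R2\<^sup>*" by (meson rtrancl_trans)
    then show "(y, f a) \<notin> R2\<^sup>*" using sym2 by blast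
  qed
  have "inj_on f A0"
    using fsep unfolding inj_on_def A0_def by (metis (lifting) mem_Collect_eq rtrancl.rtrancl_refl)
  then have "card (f ` A0) = card A0" by (rule card_image)
  moreover have "Suc (card A0) \<ge> k"
  proof -
    have "a = b" if "a \<in> A - A0" "b \<in> A - A0" for a b
    proof -
      have "a \<in> A" "b \<in> A" "(a, y1) \<in> R2\<^sup>*" "(y1, b) \<in> R2\<^sup>*" using that sym2 by (auto simp: A0_def)
      then show ?thesis using A(4) rtrancl_trans[of a y1 R2 b] by blast
    qed
    then have "card (A - A0) \<le> 1" by (metis card_le_Suc0_iff_eq A(1) finite_Diff One_nat_def)
    moreover have "card A = card A0 + card (A - A0)"
      using card_Diff_subset[of A0 A] card_mono[OF A(1), of A0] finite_subset[OF _ A(1), of A0]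
      by (simp add: A0_def)
    ultimately show ?thesis using A(2) by simp
  qed
  moreover have "f ` A0 \<inter> Y = {}" using ysep by auto
  moreover have finA0: "finite A0" using A by (simp add: A0_def)
  \<comment> \<open>At least \<open>k - 1\<close> untouched clusters and the two branches that
    \<open>R1\<close> keeps apart.\<close>
  ultimately have card: "card (f ` A0 \<union> Y) \<ge> Suc k"
    using Y(2) y12 by (subst card_Un_disjoint) auto
  have "infinite (R1\<^sup>* `` {x})" if "x \<in> f ` A0 \<union> Y" for x
  proof -
    have "infinite (O'\<^sup>* `` {x})" using that f(3) yy(2) by (auto simp: A0_def)
    then show ?thesis using Image_mono[OF sub1] by (meson finite_subset order_refl)
  qed
  moreover have "(x, y) \<notin> R1\<^sup>*" if "x \<in> f ` A0 \<union> Y" "y \<in> f ` A0 \<union> Y" "x \<noteq> y" for x y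
  proof
    assume "(x, y) \<in> R1\<^sup>*"
    moreover have "x \<noteq> u" "y \<noteq> u" using that f(2) yy(1) by (auto simp: A0_def)
    ultimately have O: "(x, y) \<in> O'\<^sup>*" using sep1 by blast
    then have "(x, y) \<in> R2\<^sup>*" using sub2 by blast
    moreover have "a = b" if "a \<in> A0" "b \<in> A0" "(f a, f b) \<in> R2\<^sup>*" for a b
      using fsep that unfolding A0_def by blast
    ultimately have "x \<in> Y \<and> y \<in> Y" using that ysep by blast
    then show False using O y12_O that(3) unfolding y12(1) by blast
  qed
  moreover have "finite (f ` A0 \<union> Y)" using finA0 y12 by simp
  ultimately have "many_infinite R1 (card (f ` A0 \<union> Y))"
    unfolding many_infinite_def by metis
  then have "many_infinite R1 (Suc k)" using card by (rule many_infinite_mono)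
  then show False using const[OF G1] unfolding R1_def by blast
qed

end

section \<open>Trifurcations and the inner boundary\<close>

text \<open>An infinite branch at an inner vertex of \<open>F\<close> must leave \<open>F\<close>
  and so meets the inner boundary. Inner trifurcations are thus branch points whose exits are
  boundary vertices.\<close>

lemma (in rewiring) card_trifurcations_le:
  assumes \<eta>: "\<eta> \<in> \<Omega>" and F: "finite F" "F \<subseteq> V"
  shows "card {x \<in> F. trifurcation V (mutual_edges V \<eta>) x} \<le> 2 * card (inner_boundary V E F)"
proof -
  let ?R = "mutual_edges V \<eta>"
  define D where "D = inner_boundary V E F"
  define T where "T = {x \<in> F - D. trifurcation V ?R x}"
  have D: "D \<subseteq> F" by (auto simp: D_def inner_boundary_def)
  have finD: "finite D" using F finite_subset[OF D] by blast
  have "branch_point ?R D x" if x: "x \<in> T" for x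
  proof -
    obtain A where A: "A \<subseteq> V" "card A = 3" "\<And>a. a \<in> A \<Longrightarrow> (x, a) \<in> ?R"
      "\<And>a. a \<in> A \<Longrightarrow> infinite ((off ?R {x})\<^sup>* `` {a})"
      "\<And>a b. a \<in> A \<Longrightarrow> b \<in> A \<Longrightarrow> a \<noteq> b \<Longrightarrow> (a, b) \<notin> (off ?R {x})\<^sup>*"
      using x by (auto simp: T_def trifurcation_def)
    have "\<exists>v. v \<in> D \<and> v \<noteq> x \<and> (a, v) \<in> (off ?R {x})\<^sup>*" if a: "a \<in> A" for a
    proof -
      have xa: "(x, a) \<in> E" using A(3)[OF a] mutual_edges_subset[OF \<eta>] by blast
      \<comment> \<open>Here it matters that \<open>x\<close> is off the boundary: its neighbours
        stay in \<open>F\<close>.\<close>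
      then have aF: "a \<in> F" "a \<noteq> x" using x A(1) a E_in_V by (auto simp: T_def D_def inner_boundary_def)
      have "\<not> (off ?R {x})\<^sup>* `` {a} \<subseteq> F"
        using A(4)[OF a] finite_subset[OF _ F(1)] by blast
      then obtain z where z: "(a, z) \<in> (off ?R {x})\<^sup>*" "z \<notin> F" by blast
      obtain v w where vw: "(a, v) \<in> (off ?R {x})\<^sup>*" "v \<in> F" "(v, w) \<in> off ?R {x}" "w \<notin> F"
        using last_exit[OF z(1) aF(1) z(2)] by blast
      have "(v, w) \<in> E" using vw(3) mutual_edges_subset[OF \<eta>] off_subset by blast
      then have "v \<in> D" using vw E_in_V by (auto simp: D_def inner_boundary_def)
      moreover have "v \<noteq> x" using vw(3) by (auto simp: off_def)
      ultimately show ?thesis using vw(1) by blast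
    qed
    then obtain f where f: "\<And>a. a \<in> A \<Longrightarrow> f a \<in> D" "\<And>a. a \<in> A \<Longrightarrow> f a \<noteq> x"
      "\<And>a. a \<in> A \<Longrightarrow> (a, f a) \<in> (off ?R {x})\<^sup>*" by metis
    have sep: "(f a, f b) \<notin> (off ?R {x})\<^sup>*" if "a \<in> A" "b \<in> A" "a \<noteq> b" for a b
    proof
      assume "(f a, f b) \<in> (off ?R {x})\<^sup>*"
      moreover have "(f b, b) \<in> (off ?R {x})\<^sup>*"
        using sym_rtranclD[OF sym_off[OF sym_mutual_edges] f(3)[OF that(2)]] .
      ultimately have "(a, b) \<in> (off ?R {x})\<^sup>*"
        using rtrancl_trans[OF f(3)[OF that(1)]] by (meson rtrancl_trans)
      then show False using A(5)[OF that] by blast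
    qed
    have inj: "inj_on f A"
    proof (rule inj_onI, rule ccontr)
      fix a b assume "a \<in> A" "b \<in> A" "f a = f b" "a \<noteq> b"
      then show False using sep[of a b] by simp
    qed
    show ?thesis
      unfolding branch_point_def
    proof (intro exI[of _ "f ` A"] conjI)
      show "f ` A \<subseteq> D - {x}" using f by auto
      show "card (f ` A) = 3" using inj A by (simp add: card_image)
      show "\<forall>y\<in>f ` A. (x, y) \<in> ?R\<^sup>*"
        using A(3) off_rtrancl_subset[OF f(3)] by (auto intro: converse_rtrancl_into_rtrancl)
      show "\<forall>y\<in>f ` A. \<forall>z\<in>f ` A. y \<noteq> z \<longrightarrow> (y, z) \<notin> (off ?R {x})\<^sup>*" using sep by auto
    qed
  qed
  moreover have "finite T" using F by (simp add: T_def)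
  ultimately have "card T \<le> card D" using card_branch_points_le[OF sym_mutual_edges _ finD] by blast
  \<comment> \<open>Trifurcations on the boundary are estimated by its size, which produces the
    factor 2.\<close>
  moreover have "{x \<in> F. trifurcation V ?R x} \<subseteq> T \<union> D" by (auto simp: T_def)
  then have "card {x \<in> F. trifurcation V ?R x} \<le> card (T \<union> D)"
    using \<open>finite T\<close> finD by (intro card_mono) auto
  ultimately show ?thesis using card_Un_le[of T D] by (simp add: D_def)
qed

section \<open>Invariance under graph isomorphisms\<close>

text \<open>Both relations live on \<open>V\<close>, so the values of \<open>f\<close> elsewhere are
  immaterial. Arbitrary relations are allowed in order to cover graphs with a deleted
  vertex.\<close>

definition rel_iso :: "'a set \<Rightarrow> ('a \<Rightarrow> 'a) \<Rightarrow> ('a \<times> 'a) set \<Rightarrow> ('a \<times> 'a) set \<Rightarrow> bool" where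
  "rel_iso V f R R' \<longleftrightarrow> bij_betw f V V \<and> R \<subseteq> V \<times> V \<and> R' \<subseteq> V \<times> V \<and>
     (\<forall>x\<in>V. \<forall>y\<in>V. (f x, f y) \<in> R' \<longleftrightarrow> (x, y) \<in> R)"

lemma rel_iso_inv:
  assumes "rel_iso V f R R'"
  shows "rel_iso V (inv_into V f) R' R"
proof -
  have f: "bij_betw f V V" using assms by (simp add: rel_iso_def)
  then have "bij_betw (inv_into V f) V V" by (rule bij_betw_inv_into)
  then show ?thesis
    using assms bij_betw_inv_into_right[OF f] bij_betwE unfolding rel_iso_def by metis
qed

lemma rel_iso_rtrancl:
  assumes "rel_iso V f R R'" "(x, y) \<in> R\<^sup>*"
  shows "(f x, f y) \<in> R'\<^sup>*"
  using assms(2)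
proof (induction rule: rtrancl_induct)
  case (step y z)
  then have "(f y, f z) \<in> R'" using assms(1) by (auto simp: rel_iso_def)
  then show ?case using step by (meson rtrancl.rtrancl_into_rtrancl)
qed simp

lemma rel_iso_rtrancl_iff:
  assumes "rel_iso V f R R'" "x \<in> V" "y \<in> V"
  shows "(f x, f y) \<in> R'\<^sup>* \<longleftrightarrow> (x, y) \<in> R\<^sup>*"
  using rel_iso_rtrancl[OF assms(1), of x y] rel_iso_rtrancl[OF rel_iso_inv[OF assms(1)], of "f x" "f y"] assms
  by (auto simp: rel_iso_def bij_betw_def)

lemma rel_iso_off:
  assumes "rel_iso V f R R'" "u \<in> V"
  shows "rel_iso V f (off R {u}) (off R' {f u})"
  using assms unfolding rel_iso_def off_def bij_betw_def inj_on_def by auto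

lemma rel_iso_infinite:
  assumes "rel_iso V f R R'" "infinite (R\<^sup>* `` {x})"
  shows "infinite (R'\<^sup>* `` {f x})"
proof -
  have f: "inj_on f V" "R \<subseteq> V \<times> V" using assms by (auto simp: rel_iso_def bij_betw_def)
  have "x \<in> V" using infinite_cluster_in_carrier[OF assms(2) f(2)] .
  then have "R\<^sup>* `` {x} \<subseteq> V" using rtrancl_in_carrier[OF _ f(2)] by blast
  then have "infinite (f ` (R\<^sup>* `` {x}))"
    using assms(2) f(1) finite_imageD inj_on_subset by blast
  moreover have "f ` (R\<^sup>* `` {x}) \<subseteq> R'\<^sup>* `` {f x}" using rel_iso_rtrancl[OF assms(1)] by blast
  ultimately show ?thesis using finite_subset by blast
qed

lemma rel_iso_many_infinite:
  assumes iso: "rel_iso V f R R'" and many: "many_infinite R m"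
  shows "many_infinite R' m"
proof -
  have f: "inj_on f V" "R \<subseteq> V \<times> V" using iso by (auto simp: rel_iso_def bij_betw_def)
  obtain A where A: "finite A" "card A = m" "\<And>x. x \<in> A \<Longrightarrow> infinite (R\<^sup>* `` {x})"
    "\<And>x y. x \<in> A \<Longrightarrow> y \<in> A \<Longrightarrow> x \<noteq> y \<Longrightarrow> (x, y) \<notin> R\<^sup>*"
    using many by (auto simp: many_infinite_def)
  have AV: "A \<subseteq> V" using infinite_cluster_in_carrier[OF A(3) f(2)] by blast
  show ?thesis
    unfolding many_infinite_def
  proof (intro exI[of _ "f ` A"] conjI)
    show "card (f ` A) = m" using A(2) f(1) AV by (metis card_image inj_on_subset)
    show "\<forall>x\<in>f ` A. infinite (R'\<^sup>* `` {x})" using rel_iso_infinite[OF iso A(3)] by blast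
    have "(f x, f y) \<notin> R'\<^sup>*" if "x \<in> A" "y \<in> A" "f x \<noteq> f y" for x y
      using rel_iso_rtrancl_iff[OF iso, of x y] A(4)[of x y] that AV by auto
    then show "\<forall>x\<in>f ` A. \<forall>y\<in>f ` A. x \<noteq> y \<longrightarrow> (x, y) \<notin> R'\<^sup>*" by blast
  qed (use A in simp)
qed

lemma rel_iso_trifurcation:
  assumes iso: "rel_iso V f R R'" and u: "u \<in> V" and tri: "trifurcation V R u"
  shows "trifurcation V R' (f u)"
proof -
  have f: "inj_on f V" "f ` V = V" using iso by (auto simp: rel_iso_def bij_betw_def)
  note iso' = rel_iso_off[OF iso u]
  obtain A where A: "A \<subseteq> V" "finite A" "card A = 3" "\<And>a. a \<in> A \<Longrightarrow> (u, a) \<in> R"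
    "\<And>x. x \<in> A \<Longrightarrow> infinite ((off R {u})\<^sup>* `` {x})"
    "\<And>x y. x \<in> A \<Longrightarrow> y \<in> A \<Longrightarrow> x \<noteq> y \<Longrightarrow> (x, y) \<notin> (off R {u})\<^sup>*"
    using tri by (auto simp: trifurcation_def)
  have "\<forall>a\<in>f ` A. (f u, a) \<in> R' \<and> infinite ((off R' {f u})\<^sup>* `` {a})"
    using A(1,4) rel_iso_infinite[OF iso' A(5)] iso u by (auto simp: rel_iso_def)
  moreover have "(f x, f y) \<notin> (off R' {f u})\<^sup>*" if "x \<in> A" "y \<in> A" "f x \<noteq> f y" for x y
    using rel_iso_rtrancl_iff[OF iso', of x y] A(6)[of x y] that A(1) by auto
  then have "\<forall>x\<in>f ` A. \<forall>y\<in>f ` A. x \<noteq> y \<longrightarrow> (x, y) \<notin> (off R' {f u})\<^sup>*" by blast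
  moreover have "f ` A \<subseteq> V" "card (f ` A) = 3" "finite (f ` A)"
    using A(1-3) f by (auto simp: card_image inj_on_subset)
  ultimately show ?thesis unfolding trifurcation_def by (intro exI[of _ "f ` A"]) simp
qed

section \<open>The number of infinite strong clusters\<close>

lemma strong_connection_eq:
  "strong_connection V \<eta> = {(x, y) \<in> V \<times> V. (x, y) \<in> (mutual_edges V \<eta>)\<^sup>*}"
proof -
  have "{(u, v). (u, v) \<in> config_edges V \<eta> \<and> (v, u) \<in> config_edges V \<eta>} = mutual_edges V \<eta>"
    by (auto simp: config_edges_def mutual_edges_def)
  then show ?thesis by (simp add: strong_connection_def)
qed

lemma strong_cluster_of_eq: "x \<in> V \<Longrightarrow> strong_cluster_of V \<eta> x = (mutual_edges V \<eta>)\<^sup>* `` {x}"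
  using rtrancl_in_carrier[OF _ mutual_edges_in_V]
  by (auto simp: strong_cluster_of_def strong_connection_eq)

lemma many_infinite_1: "many_infinite R 1 \<longleftrightarrow> (\<exists>x. infinite (R\<^sup>* `` {x}))"
proof
  assume "\<exists>x. infinite (R\<^sup>* `` {x})"
  then obtain x where "infinite (R\<^sup>* `` {x})" by blast
  then show "many_infinite R 1" unfolding many_infinite_def by (intro exI[of _ "{x}"]) simp
qed (auto simp: many_infinite_def card_1_singleton_iff)

lemma many_infinite_2:
  assumes "sym R"
  shows "many_infinite R 2 \<longleftrightarrow> (\<exists>x y. infinite (R\<^sup>* `` {x}) \<and> infinite (R\<^sup>* `` {y}) \<and> (x, y) \<notin> R\<^sup>*)"
proof
  assume "\<exists>x y. infinite (R\<^sup>* `` {x}) \<and> infinite (R\<^sup>* `` {y}) \<and> (x, y) \<notin> R\<^sup>*"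
  then obtain x y where xy: "infinite (R\<^sup>* `` {x})" "infinite (R\<^sup>* `` {y})" "(x, y) \<notin> R\<^sup>*" by blast
  then have "(y, x) \<notin> R\<^sup>*" "x \<noteq> y" using sym_rtranclD[OF assms] by blast+
  then show "many_infinite R 2" using xy unfolding many_infinite_def by (intro exI[of _ "{x, y}"]) simp
next
  assume "many_infinite R 2"
  then show "\<exists>x y. infinite (R\<^sup>* `` {x}) \<and> infinite (R\<^sup>* `` {y}) \<and> (x, y) \<notin> R\<^sup>*"
    unfolding many_infinite_def card_2_iff by blast
qed

text \<open>Two classes coincide exactly when their representatives are connected, so the family of
  infinite classes is a singleton iff it is non-empty and has no two distinct members.\<close>

lemma num_infinite_strong_clusters_eq_1:
  "num_infinite_strong_clusters V \<eta> = 1 \<longleftrightarrow>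
     many_infinite (mutual_edges V \<eta>) 1 \<and> \<not> many_infinite (mutual_edges V \<eta>) 2"
proof -
  let ?R = "mutual_edges V \<eta>"
  define \<C> where "\<C> = {C \<in> strong_clusters V \<eta>. infinite C}"
  have \<C>: "\<C> = {?R\<^sup>* `` {x} | x. infinite (?R\<^sup>* `` {x})}"
  proof -
    have sc: "strong_clusters V \<eta> = {?R\<^sup>* `` {x} | x. x \<in> V}"
      using strong_cluster_of_eq[of _ V \<eta>]
      by (auto simp: strong_clusters_def quotient_def strong_cluster_of_def)
    show ?thesis
    proof (intro equalityI subsetI)
      fix C assume "C \<in> \<C>"
      then show "C \<in> {?R\<^sup>* `` {x} | x. infinite (?R\<^sup>* `` {x})}" by (auto simp: \<C>_def sc)
    next
      fix C assume "C \<in> {?R\<^sup>* `` {x} | x. infinite (?R\<^sup>* `` {x})}"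
      then obtain x where x: "C = ?R\<^sup>* `` {x}" "infinite (?R\<^sup>* `` {x})" by auto
      then show "C \<in> \<C>"
        using infinite_cluster_in_carrier[OF x(2) mutual_edges_in_V] unfolding \<C>_def sc by auto
    qed
  qed
  have eq: "?R\<^sup>* `` {x} = ?R\<^sup>* `` {y} \<longleftrightarrow> (x, y) \<in> ?R\<^sup>*" for x y
    using sym_rtranclD[OF sym_mutual_edges, of x y V \<eta>] by (auto intro: rtrancl_trans)
  have "num_infinite_strong_clusters V \<eta> = 1 \<longleftrightarrow> (\<exists>C. \<C> = {C})"
    by (auto simp: num_infinite_strong_clusters_def \<C>_def[symmetric] Let_def one_enat_def
        card_1_singleton_iff)
  also have "\<dots> \<longleftrightarrow> \<C> \<noteq> {} \<and> \<not> (\<exists>C\<in>\<C>. \<exists>D\<in>\<C>. C \<noteq> D)"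
    by (metis insert_not_empty is_singletonI' is_singleton_def singletonD)
  also have "\<C> \<noteq> {} \<longleftrightarrow> many_infinite ?R 1" unfolding \<C> many_infinite_1 by auto
  also have "(\<exists>C\<in>\<C>. \<exists>D\<in>\<C>. C \<noteq> D) \<longleftrightarrow> many_infinite ?R 2"
    unfolding many_infinite_2[OF sym_mutual_edges] eq[symmetric] \<C> by auto
  finally show ?thesis .
qed

section \<open>Measurability\<close>

lemma pred_countable_Bex:
  assumes "countable I" "\<And>i. i \<in> I \<Longrightarrow> Measurable.pred M (P i)"
  shows "Measurable.pred M (\<lambda>x. \<exists>i\<in>I. P i x)"
proof -
  have "{x \<in> space M. \<exists>i\<in>I. P i x} = (\<Union>i\<in>I. {x \<in> space M. P i x})" by auto
  also have "\<dots> \<in> sets M" using assms by (intro sets.countable_UN'') (auto simp: pred_def)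
  finally show ?thesis by (simp add: pred_def)
qed

text \<open>Paths are decomposed by length, and the last intermediate vertex ranges over the
  countable set \<open>V\<close>.\<close>

lemma pred_rtrancl:
  assumes V: "countable V" and R: "\<And>\<eta>. R \<eta> \<subseteq> V \<times> V"
    and pred: "\<And>x y. Measurable.pred M (\<lambda>\<eta>. (x, y) \<in> R \<eta>)"
  shows "Measurable.pred M (\<lambda>\<eta>. (x, y) \<in> (R \<eta>)\<^sup>*)"
proof -
  have "Measurable.pred M (\<lambda>\<eta>. (x, y) \<in> R \<eta> ^^ n)" for n y
  proof (induction n arbitrary: y)
    case (Suc n)
    have "((x, y) \<in> R \<eta> ^^ Suc n) = (\<exists>z\<in>V. (x, z) \<in> R \<eta> ^^ n \<and> (z, y) \<in> R \<eta>)" for \<eta>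
      using R[of \<eta>] by auto
    moreover have "Measurable.pred M (\<lambda>\<eta>. \<exists>z\<in>V. (x, z) \<in> R \<eta> ^^ n \<and> (z, y) \<in> R \<eta>)"
      using Suc pred by (intro pred_countable_Bex[OF V] pred_intros_logic)
    ultimately show ?case by (simp del: relpow.simps)
  qed simp
  then show ?thesis unfolding rtrancl_power by (intro pred_intros_countable)
qed

text \<open>For countable \<open>W\<close> this writes infinity with countable quantifiers over
  membership statements, as measurability requires.\<close>

lemma infinite_iff_finite_subsets:
  "infinite S \<longleftrightarrow> (\<forall>n::nat. \<exists>A\<in>{A. finite A \<and> A \<subseteq> W}. card A = n \<and> (\<forall>y\<in>A. y \<in> S))" if "S \<subseteq> W"
proof
  assume "infinite S"
  then show "\<forall>n::nat. \<exists>A\<in>{A. finite A \<and> A \<subseteq> W}. card A = n \<and> (\<forall>y\<in>A. y \<in> S)"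
    using that by (metis (mono_tags, lifting) infinite_arbitrarily_large mem_Collect_eq order_trans subsetD)
next
  assume *: "\<forall>n::nat. \<exists>A\<in>{A. finite A \<and> A \<subseteq> W}. card A = n \<and> (\<forall>y\<in>A. y \<in> S)"
  show "infinite S"
  proof
    assume S: "finite S"
    obtain A where A: "card A = Suc (card S)" "\<forall>y\<in>A. y \<in> S" using * by blast
    then have "card A \<le> card S" using S by (intro card_mono) auto
    then show False using A by simp
  qed
qed

lemma pred_infinite_cluster:
  assumes V: "countable V" and R: "\<And>\<eta>. R \<eta> \<subseteq> V \<times> V"
    and pred: "\<And>x y. Measurable.pred M (\<lambda>\<eta>. (x, y) \<in> R \<eta>)"
  shows "Measurable.pred M (\<lambda>\<eta>. infinite ((R \<eta>)\<^sup>* `` {x}))"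
proof (cases "x \<in> V")
  case True
  have "(R \<eta>)\<^sup>* `` {x} \<subseteq> V" for \<eta> using rtrancl_in_carrier[OF _ R True] by blast
  note * = infinite_iff_finite_subsets[OF this]
  show ?thesis
    unfolding * Image_singleton_iff
    by (intro pred_intros_countable pred_countable_Bex countable_Collect_finite_subset V
        pred_intros_logic pred_intros_finite(3) pred_rtrancl[OF V R pred]) auto
next
  case False
  have "finite ((R \<eta>)\<^sup>* `` {x})" for \<eta> using infinite_cluster_in_carrier[OF _ R] False by blast
  then show ?thesis by simp
qed

lemma pred_many_infinite:
  assumes V: "countable V" and R: "\<And>\<eta>. R \<eta> \<subseteq> V \<times> V"
    and pred: "\<And>x y. Measurable.pred M (\<lambda>\<eta>. (x, y) \<in> R \<eta>)"
  shows "Measurable.pred M (\<lambda>\<eta>. many_infinite (R \<eta>) m)"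
proof -
  have *: "many_infinite (R \<eta>) m \<longleftrightarrow> (\<exists>A\<in>{A. finite A \<and> A \<subseteq> V}. card A = m \<and>
     (\<forall>x\<in>A. infinite ((R \<eta>)\<^sup>* `` {x})) \<and> (\<forall>x\<in>A. \<forall>y\<in>A. x \<noteq> y \<longrightarrow> (x, y) \<notin> (R \<eta>)\<^sup>*))" for \<eta>
    unfolding many_infinite_def using infinite_cluster_in_carrier[OF _ R[of \<eta>]] by auto
  show ?thesis
    unfolding *
    by (intro pred_countable_Bex countable_Collect_finite_subset V
        pred_intros_logic pred_intros_finite(3) pred_rtrancl[OF V R pred]
        pred_infinite_cluster[OF V R pred]) auto
qed

lemma pred_trifurcation:
  assumes V: "countable V" and R: "\<And>\<eta>. R \<eta> \<subseteq> V \<times> V"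
    and pred: "\<And>x y. Measurable.pred M (\<lambda>\<eta>. (x, y) \<in> R \<eta>)"
  shows "Measurable.pred M (\<lambda>\<eta>. trifurcation V (R \<eta>) u)"
proof -
  have *: "trifurcation V (R \<eta>) u \<longleftrightarrow> (\<exists>A\<in>{A. finite A \<and> A \<subseteq> V}. card A = 3 \<and>
     (\<forall>a\<in>A. (u, a) \<in> R \<eta> \<and> infinite ((off (R \<eta>) {u})\<^sup>* `` {a})) \<and>
     (\<forall>a\<in>A. \<forall>b\<in>A. a \<noteq> b \<longrightarrow> (a, b) \<notin> (off (R \<eta>) {u})\<^sup>*))" for \<eta>
    unfolding trifurcation_def by auto
  have R': "off (R \<eta>) {u} \<subseteq> V \<times> V" for \<eta> using R[of \<eta>] by (auto simp: off_def)
  have pred': "Measurable.pred M (\<lambda>\<eta>. (x, y) \<in> off (R \<eta>) {u})" for x y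
    using pred[of x y] by (simp add: off_def)
  show ?thesis
    unfolding *
    by (intro pred_countable_Bex countable_Collect_finite_subset V
        pred_intros_logic pred_intros_finite(3) pred_rtrancl[OF V R' pred']
        pred_infinite_cluster[OF V R' pred'] pred) auto
qed

section \<open>The probability space of configurations\<close>

locale percolation = rewiring +
  assumes countable_V: "countable V"
    and infinite_V: "infinite V"
    and transitive: "vertex_transitive V E"
    and prob_vec: "prob_vector d p"
begin

abbreviation "law x \<equiv> vertex_law d p (nbrs E x)"

abbreviation "M \<equiv> config_measure V E d p"

lemma prob_space_law: "x \<in> V \<Longrightarrow> prob_space (law x)"
  using prob_space_vertex_law[OF finite_nbrs card_nbrs prob_vec] .

sublocale prob_space M
  using prob_space_config_measure[OF regular prob_vec] .

lemma sets_law: "sets (law x) = Pow (Pow (nbrs E x))"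
  and space_law: "space (law x) = Pow (nbrs E x)"
  by (simp_all add: vertex_law_def sets_point_measure space_point_measure)

lemma space_M: "space M = \<Omega>"
  by (simp add: config_measure_def space_PiM space_law)

lemma measurable_from_law: "f \<in> measurable (law x) (count_space UNIV)"
  by (simp add: vertex_law_def)

lemma pred_mem: "x \<in> V \<Longrightarrow> Measurable.pred M (\<lambda>\<eta>. y \<in> \<eta> x)"
  unfolding config_measure_def
  by (rule measurable_compose[where N = "law x" and g = "\<lambda>S. y \<in> S"])
    (auto intro: measurable_from_law)

lemma pred_edge: "Measurable.pred M (\<lambda>\<eta>. (x, y) \<in> mutual_edges V \<eta>)"
proof (cases "x \<in> V \<and> y \<in> V")
  case True
  then show ?thesis using pred_mem[of x y] pred_mem[of y x] by (simp add: mutual_edges_def)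
next
  case False
  then have "\<And>\<eta>. (x, y) \<notin> mutual_edges V \<eta>" by (auto simp: mutual_edges_def)
  then show ?thesis by simp
qed

lemmas pred_many_infinite_mutual_edges = pred_many_infinite[OF countable_V mutual_edges_in_V pred_edge]
lemmas pred_trifurcation_mutual_edges = pred_trifurcation[OF countable_V mutual_edges_in_V pred_edge]

section \<open>Stability of almost sure properties under rewiring\<close>

text \<open>Split a configuration into its state at \<open>x\<close> and the independent rest. By
  Fubini the property holds for almost every rest at almost every state, hence at \<open>S\<close>,
  which has positive mass.\<close>

lemma AE_upd:
  assumes AE: "AE \<eta> in M. P \<eta>" and adm: "admissible x S"
  shows "AE \<eta> in M. P (\<eta>(x := S))"
proof -
  have x: "x \<in> V" "S \<subseteq> nbrs E x" "p (card S) > 0" using adm by (auto simp: admissible_def)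
  have ins: "insert x (V - {x}) = V" using x by auto
  define Q where "Q = PiM (V - {x}) law"
  interpret L: prob_space "law x" using prob_space_law x by blast
  interpret Q: prob_space Q unfolding Q_def using prob_space_law by (intro prob_space_PiM) auto
  interpret LQ: pair_sigma_finite "law x" Q ..
  have S: "S \<in> space (law x)" using x by (simp add: space_law)
  have D: "distr (law x \<Otimes>\<^sub>M Q) M (\<lambda>(s, X). X(x := s)) = M"
    using distr_pair_PiM_eq_PiM[of "V - {x}" law x] prob_space_law x
    unfolding ins Q_def config_measure_def by blast
  have m: "(\<lambda>(s, X). X(x := s)) \<in> measurable (law x \<Otimes>\<^sub>M Q) M"
    unfolding config_measure_def Q_def split_beta'
    by (rule measurable_fun_upd[where J = "V - {x}"]) (use x in auto)
  have mS: "(\<lambda>\<eta>. \<eta>(x := S)) \<in> measurable M M"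
    unfolding config_measure_def
    by (rule measurable_fun_upd[where J = V]) (use x S in auto)
  have mQ: "(\<lambda>z. (snd z)(x := S)) \<in> measurable (law x \<Otimes>\<^sub>M Q) M"
    unfolding config_measure_def Q_def
    by (rule measurable_fun_upd[where J = "V - {x}"]) (use x S in auto)
  \<comment> \<open>\<open>P\<close> need not be measurable, so its failures are covered by a
    measurable null set.\<close>
  obtain N where N: "N \<in> null_sets M" "{\<eta> \<in> space M. \<not> P \<eta>} \<subseteq> N"
    using AE by (auto simp: eventually_ae_filter)
  have N': "N \<in> sets M" using N by auto
  have "AE \<eta> in distr (law x \<Otimes>\<^sub>M Q) M (\<lambda>(s, X). X(x := s)). \<eta> \<notin> N"
    unfolding D using AE_not_in[OF N(1)] .
  then have "AE z in law x \<Otimes>\<^sub>M Q. (case z of (s, X) \<Rightarrow> X(x := s)) \<notin> N"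
    using AE_distrD[OF m] by blast
  from LQ.AE_pair[OF this] have "AE s in law x. AE X in Q. X(x := s) \<notin> N" by simp
  \<comment> \<open>Since \<open>card S\<close> is at most \<open>d\<close>, the binomial
    coefficient is non-zero. So \<open>S\<close> is an atom of \<open>law x\<close>, and what holds
    for almost every state holds for \<open>S\<close>.\<close>
  moreover have "0 < ennreal (p (card S) / real (d choose card S))"
    using x card_mono[OF finite_nbrs[OF x(1)] x(2)] card_nbrs[OF x(1)] by simp
  ultimately have QS: "AE X in Q. X(x := S) \<notin> N"
    using x(2) unfolding vertex_law_def AE_point_measure by blast
  have "{z \<in> space (law x \<Otimes>\<^sub>M Q). (snd z)(x := S) \<notin> N} =
      (\<lambda>z. (snd z)(x := S)) -` (space M - N) \<inter> space (law x \<Otimes>\<^sub>M Q)"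
    using measurable_space[OF mQ] by auto
  also have "\<dots> \<in> sets (law x \<Otimes>\<^sub>M Q)" using N' by (intro measurable_sets[OF mQ]) auto
  finally have "AE z in law x \<Otimes>\<^sub>M Q. (snd z)(x := S) \<notin> N"
    using QS by (intro LQ.AE_pair_measure) auto
  \<comment> \<open>Overwriting at \<open>x\<close> forgets the sampled state, so the statement
    about the rest is one about the whole configuration.\<close>
  then have *: "AE z in law x \<Otimes>\<^sub>M Q. (case z of (s, X) \<Rightarrow> X(x := s))(x := S) \<notin> N"
    by (simp add: split_beta')
  have "{\<eta> \<in> space M. \<eta>(x := S) \<notin> N} = (\<lambda>\<eta>. \<eta>(x := S)) -` (space M - N) \<inter> space M"
    using measurable_space[OF mS] by auto
  also have "\<dots> \<in> sets M" using N' by (intro measurable_sets[OF mS]) auto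
  finally have "AE \<eta> in distr (law x \<Otimes>\<^sub>M Q) M (\<lambda>(s, X). X(x := s)). \<eta>(x := S) \<notin> N"
    using * by (subst AE_distr_iff[OF m]) auto
  then have "AE \<eta> in M. \<eta>(x := S) \<notin> N" unfolding D .
  then show ?thesis
    by (rule AE_mp[OF _ AE_I2]) (use N(2) measurable_space[OF mS] in blast)
qed

text \<open>There are only countably many finite lists of admissible updates, and each preserves
  \<open>P\<close> almost surely. The configurations for which all of them give \<open>P\<close>
  have full measure.\<close>

lemma AE_closed_under_upd:
  assumes AE: "AE \<eta> in M. P \<eta>"
  obtains \<G> where "closed_under_upd \<G>" "\<G> \<noteq> {}" "\<And>\<eta>. \<eta> \<in> \<G> \<Longrightarrow> P \<eta>"
proof -
  define U where "U = {(x, S). admissible x S}"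
  define app where "app = fold (\<lambda>(x, S) \<eta>. (\<eta> :: 'a \<Rightarrow> 'a set)(x := S))"
  have app_Cons: "app ((x, S) # xs) \<eta> = app xs (\<eta>(x := S))" for x S xs \<eta>
    by (simp add: app_def)
  have "U \<subseteq> V \<times> {S. finite S \<and> S \<subseteq> V}"
  proof
    fix z assume "z \<in> U"
    then obtain x S where z: "z = (x, S)" "x \<in> V" "S \<subseteq> nbrs E x" by (auto simp: U_def admissible_def)
    moreover have "nbrs E x \<subseteq> V" using E_in_V by (auto simp: nbrs_def)
    ultimately show "z \<in> V \<times> {S. finite S \<and> S \<subseteq> V}" using finite_nbrs finite_subset by blast
  qed
  moreover have "countable (V \<times> {S. finite S \<and> S \<subseteq> V})"
    using countable_V countable_Collect_finite_subset by blast
  ultimately have U: "countable U" using countable_subset by blast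
  have each: "AE \<eta> in M. P (app xs \<eta>)" if "xs \<in> lists U" for xs
    using that
  proof (induction xs)
    case Nil
    then show ?case using AE by (simp add: app_def)
  next
    case (Cons z xs)
    obtain x S where z: "z = (x, S)" "admissible x S" using Cons.hyps by (auto simp: U_def)
    show ?case unfolding z(1) app_Cons by (rule AE_upd[OF Cons.IH z(2)])
  qed
  \<comment> \<open>The empty list yields \<open>P\<close>; prepending an update to a list yields
    closure.\<close>
  define \<G> where "\<G> = {\<eta> \<in> \<Omega>. \<forall>xs\<in>lists U. P (app xs \<eta>)}"
  have "AE \<eta> in M. \<forall>xs\<in>lists U. P (app xs \<eta>)"
    using each U by (subst AE_ball_countable) auto
  then have "AE \<eta> in M. \<eta> \<in> \<G>"
    by (rule AE_mp[OF _ AE_I2]) (simp add: \<G>_def space_M)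
  then have "\<G> \<noteq> {}" using AE_False by fastforce
  moreover have "closed_under_upd \<G>"
    unfolding closed_under_upd_def
  proof (intro conjI ballI allI impI)
    fix \<eta> x S assume \<eta>: "\<eta> \<in> \<G>" and adm: "admissible x S"
    have "P (app xs (\<eta>(x := S)))" if "xs \<in> lists U" for xs
    proof -
      have "(x, S) # xs \<in> lists U" using that adm by (simp add: U_def)
      then have "P (app ((x, S) # xs) \<eta>)" using \<eta> by (auto simp: \<G>_def simp del: lists.simps)
      then show ?thesis by (simp only: app_Cons)
    qed
    then show "\<eta>(x := S) \<in> \<G>" using \<eta> \<Omega>_upd[OF _ adm] by (auto simp: \<G>_def)
  qed (auto simp: \<G>_def)
  moreover have "P \<eta>" if "\<eta> \<in> \<G>" for \<eta>
  proof -
    have "P (app [] \<eta>)" using that unfolding \<G>_def by blast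
    then show ?thesis by (simp add: app_def)
  qed
  ultimately show ?thesis using that by blast
qed

section \<open>Ergodicity under automorphisms\<close>

text \<open>The push-forward along \<open>f\<close>, which moves the vertices and the elements of
  their states. Restriction to \<open>V\<close> keeps the result in the extensional product
  space.\<close>

definition translate :: "('a \<Rightarrow> 'a) \<Rightarrow> ('a \<Rightarrow> 'a set) \<Rightarrow> 'a \<Rightarrow> 'a set" where
  "translate f \<eta> = (\<lambda>x\<in>V. f ` \<eta> (inv_into V f x))"

definition cyl :: "'a set \<Rightarrow> ('a \<Rightarrow> 'a set) set \<Rightarrow> ('a \<Rightarrow> 'a set) set" where
  "cyl F C = {\<eta> \<in> space M. restrict \<eta> F \<in> C}"

lemma nbrs_subset: "nbrs E x \<subseteq> V"
  using E_in_V by (auto simp: nbrs_def)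

section \<open>Action of one automorphism on configurations\<close>

context
  fixes f g
  assumes f: "graph_automorphism V E f"
  defines "g \<equiv> inv_into V f"
begin

lemma f_bij: "bij_betw f V V" and f_inj: "inj_on f V" and f_V: "x \<in> V \<Longrightarrow> f x \<in> V"
  using f by (auto simp: graph_automorphism_def bij_betw_def)

lemma g_bij: "bij_betw g V V" and g_inj: "inj_on g V" and g_V: "x \<in> V \<Longrightarrow> g x \<in> V"
  using bij_betw_inv_into[OF f_bij] by (auto simp: g_def bij_betw_def)

lemma fg: "x \<in> V \<Longrightarrow> f (g x) = x" and gf: "x \<in> V \<Longrightarrow> g (f x) = x"
  using bij_betw_inv_into_right[OF f_bij] bij_betw_inv_into_left[OF f_bij] by (auto simp: g_def)

lemma image_nbrs: "x \<in> V \<Longrightarrow> f ` nbrs E x = nbrs E (f x)"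
proof (intro equalityI subsetI)
  fix y assume "x \<in> V" "y \<in> f ` nbrs E x"
  then show "y \<in> nbrs E (f x)" using f E_in_V by (auto simp: graph_automorphism_def nbrs_def)
next
  fix y assume x: "x \<in> V" and y: "y \<in> nbrs E (f x)"
  have "y \<in> V" using y nbrs_subset by blast
  have "(f x, f (g y)) \<in> E" using y fg[OF \<open>y \<in> V\<close>] by (simp add: nbrs_def)
  then have "g y \<in> nbrs E x"
    using f x g_V[OF \<open>y \<in> V\<close>] unfolding graph_automorphism_def nbrs_def by blast
  then show "y \<in> f ` nbrs E x" using fg[OF \<open>y \<in> V\<close>] by force
qed

text \<open>The map \<open>f\<close> is a bijection between the states at \<open>x\<close> and those
  at \<open>f x\<close>, and the weights depend only on cardinality.\<close>

lemma emeasure_law_image: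
  assumes x: "x \<in> V" and A: "A \<in> sets (law (f x))"
  shows "emeasure (law x) ((`) f -` A \<inter> space (law x)) = emeasure (law (f x)) A"
proof -
  have inj: "inj_on f (nbrs E x)" using f_inj nbrs_subset inj_on_subset by blast
  have AS: "A \<subseteq> Pow (nbrs E (f x))" using A by (simp add: sets_law)
  have fin: "finite (Pow (nbrs E x))" "finite (Pow (nbrs E (f x)))"
    using finite_nbrs f_V x by auto
  let ?B = "(`) f -` A \<inter> space (law x)"
  have B: "?B \<subseteq> Pow (nbrs E x)" by (auto simp: space_law)
  let ?w = "\<lambda>S :: 'a set. ennreal (p (card S) / real (d choose card S))"
  have bij: "bij_betw ((`) f) ?B A"
    unfolding bij_betw_def
  proof
    show "inj_on ((`) f) ?B" using inj_on_subset[OF inj_on_image_Pow[OF inj] B] .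
    show "(`) f ` ?B = A"
    proof (intro equalityI subsetI)
      fix S assume S: "S \<in> A"
      then have "S \<subseteq> f ` nbrs E x" using AS image_nbrs[OF x] by auto
      then obtain T where "T \<subseteq> nbrs E x" "S = f ` T" by (auto simp: subset_image_iff)
      then show "S \<in> (`) f ` ?B" using S by (auto simp: space_law)
    qed auto
  qed
  have "emeasure (law x) ?B = (\<Sum>S\<in>?B. ?w S)"
    unfolding vertex_law_def using fin B
    by (intro emeasure_point_measure_finite) (auto simp: space_law vertex_law_def)
  also have "\<dots> = (\<Sum>S\<in>?B. ?w (f ` S))"
  proof (rule sum.cong[OF refl])
    fix S assume "S \<in> ?B"
    then have "inj_on f S" using inj inj_on_subset by (auto simp: space_law)
    then show "?w S = ?w (f ` S)" by (simp add: card_image)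
  qed
  also have "\<dots> = (\<Sum>S\<in>A. ?w S)" by (rule sum.reindex_bij_betw[OF bij])
  also have "\<dots> = emeasure (law (f x)) A"
    unfolding vertex_law_def using fin AS by (intro emeasure_point_measure_finite[symmetric]) auto
  finally show ?thesis .
qed

lemma measurable_image_law: "x \<in> V \<Longrightarrow> (`) f \<in> measurable (law (g x)) (law x)"
  using image_nbrs[of "g x"] fg[of x] g_V[of x] by (auto simp: vertex_law_def space_point_measure)

lemma measurable_translate_restrict:
  assumes "F \<subseteq> V"
  shows "(\<lambda>\<eta>. \<lambda>x\<in>F. f ` \<eta> (g x)) \<in> measurable (PiM (g ` F) law) (PiM F law)"
proof (rule measurable_restrict)
  fix x assume "x \<in> F"
  then show "(\<lambda>\<eta>. f ` \<eta> (g x)) \<in> measurable (PiM (g ` F) law) (law x)"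
    using assms by (intro measurable_compose[OF _ measurable_image_law]) auto
qed

lemma measurable_translate: "translate f \<in> measurable M M"
proof -
  have "(\<lambda>\<eta>. \<lambda>x\<in>V. f ` \<eta> (g x)) \<in> measurable (PiM (g ` V) law) (PiM V law)"
    by (rule measurable_translate_restrict) simp
  moreover have "g ` V = V" using g_bij by (simp add: bij_betw_def)
  ultimately show ?thesis
    unfolding config_measure_def translate_def[abs_def] g_def by simp
qed

lemma distr_translate: "distr M M (translate f) = M"
proof (rule measure_eqI_PiM_infinite[symmetric, where I = V and M = law])
  show "sets M = sets (PiM V law)" "sets (distr M M (translate f)) = sets (PiM V law)"
    by (simp_all add: config_measure_def)
  show "finite_measure M" by unfold_locales
  fix A J assume J: "finite J" "J \<subseteq> V" and A: "\<And>i. i \<in> J \<Longrightarrow> A i \<in> sets (law i)"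
  let ?A = "\<lambda>i. (`) f -` A (f i) \<inter> space (law i)"
  have gJ: "g ` J \<subseteq> V" "finite (g ` J)" using g_V J by auto
  have sA: "?A i \<in> sets (law i)" for i by (simp add: sets_law space_law)
  have "translate f -` prod_emb V law J (Pi\<^sub>E J A) \<inter> space M = prod_emb V law (g ` J) (Pi\<^sub>E (g ` J) ?A)"
  proof (intro equalityI subsetI)
    fix \<eta> assume \<eta>: "\<eta> \<in> translate f -` prod_emb V law J (Pi\<^sub>E J A) \<inter> space M"
    have "f ` \<eta> (g j) \<in> A j" if "j \<in> J" for j
    proof -
      have "restrict (translate f \<eta>) J \<in> Pi\<^sub>E J A" using \<eta> by (simp add: prod_emb_iff)
      from PiE_mem[OF this that] show ?thesis using that J by (auto simp: translate_def g_def)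
    qed
    moreover have "\<eta> \<in> \<Omega>" using \<eta> space_M by auto
    ultimately show "\<eta> \<in> prod_emb V law (g ` J) (Pi\<^sub>E (g ` J) ?A)"
      using gJ fg J by (auto simp: prod_emb_iff space_law PiE_iff) blast
  next
    fix \<eta> assume \<eta>: "\<eta> \<in> prod_emb V law (g ` J) (Pi\<^sub>E (g ` J) ?A)"
    then have sp: "\<eta> \<in> space M" by (auto simp: prod_emb_iff space_M space_law PiE_iff)
    have 1: "f ` \<eta> (g j) \<in> A j" if "j \<in> J" for j
    proof -
      have "restrict \<eta> (g ` J) \<in> Pi\<^sub>E (g ` J) ?A" using \<eta> by (simp add: prod_emb_iff)
      from PiE_mem[OF this, of "g j"] have "f ` \<eta> (g j) \<in> A (f (g j))" using that by simp
      then show ?thesis using fg J that by auto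
    qed
    have "translate f \<eta> \<in> \<Omega>" using measurable_space[OF measurable_translate sp] space_M by simp
    then have "translate f \<eta> \<in> prod_emb V law J (Pi\<^sub>E J A)"
      using 1 J by (auto simp: prod_emb_iff space_law PiE_iff translate_def g_def subset_iff)
    then show "\<eta> \<in> translate f -` prod_emb V law J (Pi\<^sub>E J A) \<inter> space M" using sp by simp
  qed
  then have "emeasure (distr M M (translate f)) (prod_emb V law J (Pi\<^sub>E J A)) =
      emeasure M (prod_emb V law (g ` J) (Pi\<^sub>E (g ` J) ?A))"
    using J A by (subst emeasure_distr[OF measurable_translate])
      (auto simp: config_measure_def intro!: sets_PiM_I)
  also have "\<dots> = (\<Prod>i\<in>g ` J. emeasure (law i) (?A i))"
    unfolding config_measure_def
    using gJ sA prob_space_law by (intro emeasure_PiM_emb) auto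
  also have "\<dots> = (\<Prod>j\<in>J. emeasure (law (g j)) (?A (g j)))"
    using inj_on_subset[OF g_inj J(2)] by (simp add: prod.reindex)
  also have "\<dots> = (\<Prod>j\<in>J. emeasure (law j) (A j))"
  proof (rule prod.cong[OF refl])
    fix j assume "j \<in> J"
    then show "emeasure (law (g j)) (?A (g j)) = emeasure (law j) (A j)"
      using emeasure_law_image[of "g j" "A j"] A g_V fg J by (auto simp: subset_iff)
  qed
  also have "\<dots> = emeasure M (prod_emb V law J (Pi\<^sub>E J A))"
    unfolding config_measure_def
    using J A prob_space_law by (intro emeasure_PiM_emb[symmetric]) auto
  finally show "emeasure M (prod_emb V law J (Pi\<^sub>E J A)) =
      emeasure (distr M M (translate f)) (prod_emb V law J (Pi\<^sub>E J A))" by simp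
qed

lemma prob_translate: "A \<in> sets M \<Longrightarrow> prob (translate f -` A \<inter> space M) = prob A"
  using measure_distr[OF measurable_translate, of A] by (simp add: distr_translate)

lemma rel_iso_translate:
  assumes \<eta>: "\<eta> \<in> \<Omega>"
  shows "rel_iso V f (mutual_edges V \<eta>) (mutual_edges V (translate f \<eta>))"
proof -
  have "f y \<in> translate f \<eta> (f x) \<longleftrightarrow> y \<in> \<eta> x" if "x \<in> V" "y \<in> V" for x y
  proof -
    have "\<eta> x \<subseteq> V" using \<eta> that nbrs_subset by (auto simp: PiE_iff)
    moreover have "translate f \<eta> (f x) = f ` \<eta> x" using that f_V gf by (simp add: translate_def g_def)
    ultimately show ?thesis using inj_on_image_mem_iff[OF f_inj] that by blast
  qed
  then show ?thesis using f_bij f_V unfolding rel_iso_def mutual_edges_def by auto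
qed

lemma prob_trifurcation_translate:
  assumes x: "x \<in> V"
  shows "prob {\<eta> \<in> space M. trifurcation V (mutual_edges V \<eta>) (f x)} =
    prob {\<eta> \<in> space M. trifurcation V (mutual_edges V \<eta>) x}"
proof -
  have "trifurcation V (mutual_edges V (translate f \<eta>)) (f x) \<longleftrightarrow> trifurcation V (mutual_edges V \<eta>) x"
    if "\<eta> \<in> \<Omega>" for \<eta>
    using rel_iso_trifurcation[OF rel_iso_translate[OF that] x]
      rel_iso_trifurcation[OF rel_iso_inv[OF rel_iso_translate[OF that]] f_V[OF x]] gf[OF x]
    by (auto simp: g_def)
  then have "translate f -` {\<eta> \<in> space M. trifurcation V (mutual_edges V \<eta>) (f x)} \<inter> space M =
      {\<eta> \<in> space M. trifurcation V (mutual_edges V \<eta>) x}"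
    using measurable_space[OF measurable_translate] by (auto simp: space_M)
  then show ?thesis
    using prob_translate[of "{\<eta> \<in> space M. trifurcation V (mutual_edges V \<eta>) (f x)}"] pred_trifurcation_mutual_edges
    by (simp add: pred_def)
qed

lemma many_infinite_translate:
  assumes "\<eta> \<in> \<Omega>"
  shows "many_infinite (mutual_edges V (translate f \<eta>)) m \<longleftrightarrow> many_infinite (mutual_edges V \<eta>) m"
  using rel_iso_many_infinite[OF rel_iso_translate[OF assms]]
    rel_iso_many_infinite[OF rel_iso_inv[OF rel_iso_translate[OF assms]]] by blast

lemma translate_cyl:
  assumes F: "F \<subseteq> V" and C: "C \<in> sets (PiM F law)"
  obtains C' where "C' \<in> sets (PiM (g ` F) law)" "translate f -` cyl F C \<inter> space M = cyl (g ` F) C'"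
proof
  let ?h = "\<lambda>\<eta>. \<lambda>x\<in>F. f ` \<eta> (g x)"
  let ?C = "?h -` C \<inter> space (PiM (g ` F) law)"
  show "?C \<in> sets (PiM (g ` F) law)" using measurable_translate_restrict[OF F] C by (rule measurable_sets)
  have "restrict (translate f \<eta>) F = ?h (restrict \<eta> (g ` F))" for \<eta>
    using F by (auto simp: translate_def g_def fun_eq_iff)
  moreover have "restrict \<eta> (g ` F) \<in> space (PiM (g ` F) law)" if "\<eta> \<in> space M" for \<eta>
    using that F g_V by (auto simp: space_M space_PiM space_law PiE_iff subset_iff)
  ultimately show "translate f -` cyl F C \<inter> space M = cyl (g ` F) ?C"
    using measurable_space[OF measurable_translate] by (auto simp: cyl_def)
qed

end

section \<open>Cylinder approximation and independence\<close>

lemma prob_diff_le_sym_diff: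
  assumes "A \<in> sets M" "B \<in> sets M"
  shows "\<bar>prob A - prob B\<bar> \<le> prob (sym_diff A B)"
proof -
  have "prob A \<le> prob (B \<union> sym_diff A B)" "prob B \<le> prob (A \<union> sym_diff A B)"
    using assms by (intro finite_measure_mono; auto)+
  moreover have "prob (B \<union> sym_diff A B) \<le> prob B + prob (sym_diff A B)"
    "prob (A \<union> sym_diff A B) \<le> prob A + prob (sym_diff A B)"
    using assms by (intro measure_Un_le; auto)+
  ultimately show ?thesis by linarith
qed

lemma restrict_in_space: "F \<subseteq> V \<Longrightarrow> \<eta> \<in> space M \<Longrightarrow> restrict \<eta> F \<in> space (PiM F law)"
  by (auto simp: space_M space_PiM space_law PiE_iff)

lemma cyl_sets: "F \<subseteq> V \<Longrightarrow> C \<in> sets (PiM F law) \<Longrightarrow> cyl F C \<in> sets M"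
proof -
  assume F: "F \<subseteq> V" and C: "C \<in> sets (PiM F law)"
  have "(\<lambda>\<eta>. restrict \<eta> F) \<in> measurable M (PiM F law)"
    unfolding config_measure_def using F by (rule measurable_restrict_subset)
  from measurable_sets[OF this C] show ?thesis by (simp add: cyl_def vimage_def Int_def conj_commute)
qed

text \<open>The approximable events form a \<sigma>-algebra containing the coordinate events.
  Complements leave symmetric differences unchanged; a countable union is first truncated.\<close>

lemma approx_by_cylinder:
  assumes "A \<in> sets M" "e > 0"
  obtains F C where "finite F" "F \<subseteq> V" "C \<in> sets (PiM F law)" "prob (sym_diff A (cyl F C)) < e"
proof -
  have gen: "sets M = sigma_sets \<Omega> {{f \<in> \<Omega>. f i \<in> A} | i A. i \<in> V \<and> A \<in> sets (law i)}"
    unfolding config_measure_def sets_PiM_single space_law ..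
  have "\<forall>e>0. \<exists>F C. finite F \<and> F \<subseteq> V \<and> C \<in> sets (PiM F law) \<and> prob (sym_diff A (cyl F C)) < e"
    using assms(1) unfolding gen
  proof (induction rule: sigma_sets.induct)
    case (Basic A)
    then obtain i B where A: "A = {f \<in> \<Omega>. f i \<in> B}" "i \<in> V" "B \<in> sets (law i)" by blast
    let ?C = "{X \<in> space (PiM {i} law). X i \<in> B}"
    have "?C \<in> sets (PiM {i} law)" using A(3) by measurable
    moreover have "A = cyl {i} ?C"
      using A restrict_in_space[of "{i}"] by (auto simp: cyl_def space_M)
    then have "prob (sym_diff A (cyl {i} ?C)) = 0" by simp
    ultimately show ?case using A(2)
      by (intro allI impI exI[of _ "{i}"] exI[of _ ?C]) simp
  next
    case Empty
    then show ?case by (intro allI impI exI[of _ "{}"]) (simp add: cyl_def)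
  next
    case (Compl A)
    show ?case
    proof (intro allI impI)
      fix e :: real assume e: "e > 0"
      obtain F C where FC: "finite F" "F \<subseteq> V" "C \<in> sets (PiM F law)" "prob (sym_diff A (cyl F C)) < e"
        using Compl.IH[rule_format, OF e] by (elim exE conjE)
      have "A \<subseteq> \<Omega>" using sets.sets_into_space[of A M] Compl.hyps by (simp add: gen space_M)
      then have "sym_diff (\<Omega> - A) (cyl F (space (PiM F law) - C)) = sym_diff A (cyl F C)"
        using restrict_in_space[OF FC(2)] by (auto simp: cyl_def space_M)
      moreover have "space (PiM F law) - C \<in> sets (PiM F law)" using FC(3) by blast
      ultimately show "\<exists>F C. finite F \<and> F \<subseteq> V \<and> C \<in> sets (PiM F law) \<and> prob (sym_diff (\<Omega> - A) (cyl F C)) < e"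
        using FC by metis
    qed
  next
    case (Union A)
    have A: "A i \<in> sets M" for i using Union.hyps by (simp add: gen)
    show ?case
    proof (intro allI impI)
      fix e :: real assume e: "e > 0"
      define B where "B n = (\<Union>i<n. A i)" for n :: nat
      have B: "B n \<in> sets M" for n using A by (auto simp: B_def)
      have "incseq B" unfolding B_def by (intro incseq_SucI) (auto simp: less_Suc_eq)
      then have "(\<lambda>n. prob (B n)) \<longlonglongrightarrow> prob (\<Union>n. B n)"
        using B by (intro finite_Lim_measure_incseq) auto
      moreover have UB: "(\<Union>n. B n) = (\<Union>i. A i)" by (auto simp: B_def)
      ultimately have "eventually (\<lambda>n. prob (\<Union>i. A i) - e / 2 < prob (B n)) sequentially"
        using e by (intro order_tendstoD(1)[where y = "prob (\<Union>i. A i)"]) auto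
      then obtain n where n: "prob (\<Union>i. A i) - e / 2 < prob (B n)"
        by (auto simp: eventually_sequentially)
      \<comment> \<open>Half of \<open>e\<close> is spent on truncation and half on the first
        \<open>n\<close> approximations. Using \<open>n + 1\<close> avoids a zero denominator for
        \<open>n = 0\<close>.\<close>
      have e': "e / (2 * (real n + 1)) > 0" using e by simp
      have "\<exists>F C. finite F \<and> F \<subseteq> V \<and> C \<in> sets (PiM F law) \<and>
          prob (sym_diff (A i) (cyl F C)) < e / (2 * (real n + 1))" for i
        by (rule Union.IH[rule_format, OF e'])
      then obtain F C where FC: "\<And>i. finite (F i)" "\<And>i. F i \<subseteq> V" "\<And>i. C i \<in> sets (PiM (F i) law)"
        "\<And>i. prob (sym_diff (A i) (cyl (F i) (C i))) < e / (2 * (real n + 1))"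
        by metis
      define F' where "F' = (\<Union>i<n. F i)"
      \<comment> \<open>The first \<open>n\<close> cylinders, rewritten over their common coordinate
        set.\<close>
      define C' where "C' = (\<Union>i<n. (\<lambda>X. restrict X (F i)) -` C i \<inter> space (PiM F' law))"
      have F': "finite F'" "F' \<subseteq> V" using FC by (auto simp: F'_def)
      have "(\<lambda>X. restrict X (F i)) \<in> measurable (PiM F' law) (PiM (F i) law)" if "i < n" for i
        using that by (intro measurable_restrict_subset) (auto simp: F'_def)
      then have C': "C' \<in> sets (PiM F' law)"
        unfolding C'_def using FC(3) by (intro sets.finite_UN measurable_sets) auto
      have "cyl F' C' = (\<Union>i<n. cyl (F i) (C i))"
      proof -
        have "restrict (restrict \<eta> F') (F i) = restrict \<eta> (F i)" if "i < n" for \<eta> :: "'a \<Rightarrow> 'a set" and i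
        proof -
          have "F' \<inter> F i = F i" using that by (auto simp: F'_def)
          then show ?thesis by (simp add: restrict_restrict)
        qed
        then show ?thesis using restrict_in_space[OF F'(2)] by (auto simp: cyl_def C'_def)
      qed
      then have sub: "sym_diff (\<Union>i. A i) (cyl F' C') \<subseteq>
          ((\<Union>i. A i) - B n) \<union> (\<Union>i<n. sym_diff (A i) (cyl (F i) (C i)))"
        by (auto simp: B_def)
      have sd: "sym_diff (A i) (cyl (F i) (C i)) \<in> sets M" for i
        using A cyl_sets[OF FC(2,3)] by blast
      have "prob (sym_diff (\<Union>i. A i) (cyl F' C')) \<le>
          prob (((\<Union>i. A i) - B n) \<union> (\<Union>i<n. sym_diff (A i) (cyl (F i) (C i))))"
        using A B sd by (intro finite_measure_mono[OF sub]) auto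
      also have "\<dots> \<le> prob ((\<Union>i. A i) - B n) + prob (\<Union>i<n. sym_diff (A i) (cyl (F i) (C i)))"
        using A B sd by (intro measure_Un_le) auto
      also have "prob ((\<Union>i. A i) - B n) = prob (\<Union>i. A i) - prob (B n)"
        using A B UB by (intro finite_measure_Diff) auto
      also have "prob (\<Union>i<n. sym_diff (A i) (cyl (F i) (C i))) \<le>
          (\<Sum>i<n. prob (sym_diff (A i) (cyl (F i) (C i))))"
        using sd by (intro finite_measure_subadditive_finite) auto
      also have "\<dots> \<le> (\<Sum>i<n. e / (2 * (real n + 1)))"
        using FC(4) by (intro sum_mono less_imp_le)
      also have "\<dots> \<le> e / 2" using e by (simp add: field_simps)
      finally have "prob (sym_diff (\<Union>i. A i) (cyl F' C')) < e" using n by linarith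
      then show "\<exists>F C. finite F \<and> F \<subseteq> V \<and> C \<in> sets (PiM F law) \<and> prob (sym_diff (\<Union>i. A i) (cyl F C)) < e"
        using F' C' by blast
    qed
  qed
  then show ?thesis using assms(2) that by blast
qed

text \<open>The joint law of the coordinates is the product of their marginals, so they are
  independent, and so are groups of them over disjoint index sets.\<close>

lemma indep_cyl:
  assumes F: "F \<subseteq> V" "F' \<subseteq> V" "F \<inter> F' = {}"
    and C: "C \<in> sets (PiM F law)" "C' \<in> sets (PiM F' law)"
  shows "prob (cyl F C \<inter> cyl F' C') = prob (cyl F C) * prob (cyl F' C')"
proof -
  have comp: "(\<lambda>\<eta>. \<eta> i) \<in> measurable M (law i)" if "i \<in> V" for i
    unfolding config_measure_def using that by simp
  have "indep_vars law (\<lambda>i \<eta>. \<eta> i) V"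
  proof (subst indep_vars_iff_distr_eq_PiM')
    have "distr M (PiM V law) (\<lambda>\<eta>. \<lambda>i\<in>V. \<eta> i) = distr M M (\<lambda>\<eta>. \<eta>)"
      by (rule distr_cong) (auto simp: config_measure_def space_PiM PiE_restrict)
    also have "\<dots> = PiM V law" by (simp add: config_measure_def)
    also have "\<dots> = PiM V (\<lambda>i. distr M (law i) (\<lambda>\<eta>. \<eta> i))"
      unfolding config_measure_def
      using distr_PiM_component[of V law] prob_space_law by (intro PiM_cong) auto
    finally show "distr M (PiM V law) (\<lambda>\<eta>. \<lambda>i\<in>V. \<eta> i) = PiM V (\<lambda>i. distr M (law i) (\<lambda>\<eta>. \<eta> i))" .
  qed (use infinite_V comp in auto)
  from indep_varD[OF indep_var_restrict[OF this F(3,1,2)] C]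
  have "prob ((\<lambda>\<eta>. (restrict \<eta> F, restrict \<eta> F')) -` (C \<times> C') \<inter> space M) =
      prob ((\<lambda>\<eta>. restrict \<eta> F) -` C \<inter> space M) * prob ((\<lambda>\<eta>. restrict \<eta> F') -` C' \<inter> space M)"
    by simp
  moreover have "(\<lambda>\<eta>. (restrict \<eta> F, restrict \<eta> F')) -` (C \<times> C') \<inter> space M = cyl F C \<inter> cyl F' C'"
    by (auto simp: cyl_def)
  moreover have "(\<lambda>\<eta>. restrict \<eta> F) -` C \<inter> space M = cyl F C"
    "(\<lambda>\<eta>. restrict \<eta> F') -` C' \<inter> space M = cyl F' C'"
    by (auto simp: cyl_def)
  ultimately show ?thesis by simp
qed

section \<open>Moving a finite set off itself; the zero-one law\<close>

lemma finite_relpow_Image: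
  assumes "x \<in> V" shows "finite ((E ^^ n) `` {x})" and "(E ^^ n) `` {x} \<subseteq> V"
proof -
  have "finite ((E ^^ n) `` {x}) \<and> (E ^^ n) `` {x} \<subseteq> V"
  proof (induction n)
    case (Suc n)
    have "(E ^^ Suc n) `` {x} = (\<Union>y\<in>(E ^^ n) `` {x}. nbrs E y)" by (auto simp: nbrs_def)
    then show ?case using Suc finite_nbrs nbrs_subset by auto
  qed (use assms in auto)
  then show "finite ((E ^^ n) `` {x})" "(E ^^ n) `` {x} \<subseteq> V" by auto
qed

text \<open>If \<open>f ` F\<close> meets \<open>F\<close>, then \<open>f\<close> moves a fixed vertex \<open>v\<close> by a bounded distance, and balls are finite.\<close>

lemma ex_automorphism_disjoint:
  assumes F: "finite F" "F \<subseteq> V"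
  obtains f where "graph_automorphism V E f" "F \<inter> inv_into V f ` F = {}"
proof -
  obtain v where v: "v \<in> V" using infinite_V by fastforce
  have "\<exists>n. (v, x) \<in> E ^^ n" if "x \<in> F" for x
    using conn_E that F v rtrancl_power[of "(v, x)" E] by (auto simp: connected_graph_def)
  then obtain r where r: "\<And>x. x \<in> F \<Longrightarrow> (v, x) \<in> E ^^ r x" by metis
  \<comment> \<open>These are the possible positions of \<open>f v\<close> when \<open>f\<close>
    maps some \<open>x\<close> in \<open>F\<close> to some \<open>y\<close> in
    \<open>F\<close>.\<close>
  define D where "D = (\<Union>x\<in>F. \<Union>y\<in>F. (E ^^ (r x + r y)) `` {v})"
  have "finite D" using F finite_relpow_Image(1)[OF v] by (auto simp: D_def)
  then obtain w where w: "w \<in> V" "w \<notin> D" using infinite_V by (meson finite_subset subsetI)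
  obtain f where f: "graph_automorphism V E f" "f v = w"
    using transitive v w by (auto simp: vertex_transitive_def)
  have relpow: "(f x, f y) \<in> E ^^ n" if "(x, y) \<in> E ^^ n" for x y n
    using that
  proof (induction n arbitrary: y)
    case (Suc n)
    then obtain z where z: "(x, z) \<in> E ^^ n" "(z, y) \<in> E" by auto
    then have "(f z, f y) \<in> E" using f(1) E_in_V by (auto simp: graph_automorphism_def)
    then show ?case using Suc.IH z by auto
  qed simp
  have sym: "(y, x) \<in> E ^^ n" if "(x, y) \<in> E ^^ n" for x y n
    using that
  proof (induction n arbitrary: y)
    case (Suc n)
    then obtain z where z: "(x, z) \<in> E ^^ n" "(z, y) \<in> E" by auto
    then have "(y, z) \<in> E" using sym_E by (meson symD)
    then show ?case using Suc.IH[OF z(1)] by (rule relpow_Suc_I2)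
  qed simp
  have "f x \<notin> F" if x: "x \<in> F" for x
  proof
    assume fx: "f x \<in> F"
    have "(f x, w) \<in> E ^^ r x" using sym[OF relpow[OF r[OF x]]] f(2) by simp
    then have "(v, w) \<in> E ^^ (r (f x) + r x)" using r[OF fx] by (auto simp: relpow_add)
    then show False using w x fx by (auto simp: D_def)
  qed
  moreover have "f (inv_into V f y) = y" if "y \<in> F" for y
    using fg[OF f(1)] that F(2) by blast
  ultimately have "F \<inter> inv_into V f ` F = {}" by force
  then show ?thesis using that f(1) by blast
qed

text \<open>Approximate \<open>A\<close> by a cylinder event and move its coordinates off
  themselves. The moved event is independent, equally likely, and approximates the invariant
  \<open>A\<close> equally well, so \<open>prob A\<close> is close to its own square.\<close>

lemma ergodic:
  assumes A: "A \<in> sets M"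
    and inv: "\<And>f. graph_automorphism V E f \<Longrightarrow> translate f -` A \<inter> space M = A"
  shows "prob A = 0 \<or> prob A = 1"
proof -
  have "\<bar>prob A - prob A * prob A\<bar> \<le> 4 * e" if e: "e > 0" for e
  proof -
    obtain F C where FC: "finite F" "F \<subseteq> V" "C \<in> sets (PiM F law)" "prob (sym_diff A (cyl F C)) < e"
      using approx_by_cylinder[OF A e] .
    obtain f where f: "graph_automorphism V E f" "F \<inter> inv_into V f ` F = {}"
      using ex_automorphism_disjoint[OF FC(1,2)] .
    let ?g = "inv_into V f" and ?B = "cyl F C"
    obtain C' where C': "C' \<in> sets (PiM (?g ` F) law)" "translate f -` ?B \<inter> space M = cyl (?g ` F) C'"
      using translate_cyl[OF f(1) FC(2,3)] .
    let ?B' = "cyl (?g ` F) C'"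
    have gF: "?g ` F \<subseteq> V" using g_V[OF f(1)] FC(2) by auto
    have sets: "?B \<in> sets M" "?B' \<in> sets M" using cyl_sets FC C' gF by auto
    have "prob (?B \<inter> ?B') = prob ?B * prob ?B'"
      using indep_cyl[OF FC(2) gF f(2) FC(3) C'(1)] .
    also have "prob ?B' = prob ?B" using prob_translate[OF f(1) sets(1)] C'(2) by simp
    finally have ind: "prob (?B \<inter> ?B') = prob ?B * prob ?B" .
    have "translate f -` sym_diff A ?B \<inter> space M = sym_diff A ?B'"
      using inv[OF f(1)] C'(2) by blast
    then have sd': "prob (sym_diff A ?B') = prob (sym_diff A ?B)"
      using prob_translate[OF f(1), of "sym_diff A ?B"] A sets by auto
    have "\<bar>prob A - prob (?B \<inter> ?B')\<bar> \<le> prob (sym_diff A (?B \<inter> ?B'))"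
      using A sets by (intro prob_diff_le_sym_diff) auto
    also have "\<dots> \<le> prob (sym_diff A ?B \<union> sym_diff A ?B')"
      using A sets by (intro finite_measure_mono) auto
    also have "\<dots> \<le> prob (sym_diff A ?B) + prob (sym_diff A ?B')"
      using A sets by (intro measure_Un_le) auto
    finally have 1: "\<bar>prob A - prob ?B * prob ?B\<bar> < 2 * e" using ind sd' FC(4) by linarith
    have 2: "\<bar>prob A - prob ?B\<bar> < e" using prob_diff_le_sym_diff[OF A sets(1)] FC(4) by linarith
    have "\<bar>prob A * prob A - prob ?B * prob ?B\<bar> = \<bar>prob A - prob ?B\<bar> * \<bar>prob A + prob ?B\<bar>"
      unfolding abs_mult[symmetric] by (rule arg_cong[where f = abs]) (simp add: algebra_simps)
    also have "\<dots> \<le> e * 2"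
    proof (rule mult_mono)
      show "\<bar>prob A + prob ?B\<bar> \<le> 2"
        using prob_le_1[of A] prob_le_1[of ?B] measure_nonneg[of M A] measure_nonneg[of M ?B] by linarith
    qed (use 2 e in auto)
    finally show ?thesis using 1 by linarith
  qed
  \<comment> \<open>With this choice of \<open>e\<close>, a positive difference would be at most
    half of itself.\<close>
  from this[of "\<bar>prob A - prob A * prob A\<bar> / 8"] have "\<bar>prob A - prob A * prob A\<bar> \<le> 0"
    by fastforce
  then have "prob A * (1 - prob A) = 0" by (simp add: algebra_simps)
  then show ?thesis by simp
qed

lemma prob_many_0_1:
  "prob {\<eta> \<in> space M. many_infinite (mutual_edges V \<eta>) m} = 0 \<or>
   prob {\<eta> \<in> space M. many_infinite (mutual_edges V \<eta>) m} = 1"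
proof (rule ergodic)
  show "{\<eta> \<in> space M. many_infinite (mutual_edges V \<eta>) m} \<in> sets M"
    using pred_many_infinite_mutual_edges by (simp add: pred_def)
  show "translate f -` {\<eta> \<in> space M. many_infinite (mutual_edges V \<eta>) m} \<inter> space M =
      {\<eta> \<in> space M. many_infinite (mutual_edges V \<eta>) m}" if "graph_automorphism V E f" for f
    using measurable_space[OF measurable_translate[OF that]] many_infinite_translate[OF that]
    by (auto simp: space_M)
qed

lemma AE_many_or_not:
  "(AE \<eta> in M. many_infinite (mutual_edges V \<eta>) m) \<or> (AE \<eta> in M. \<not> many_infinite (mutual_edges V \<eta>) m)"
proof -
  have ev: "{\<eta> \<in> space M. many_infinite (mutual_edges V \<eta>) m} \<in> sets M"
    using pred_many_infinite_mutual_edges by (simp add: pred_def)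
  show ?thesis
    using prob_many_0_1[of m] prob_Collect_eq_1[OF ev] prob_Collect_eq_0[OF ev] by auto
qed

section \<open>The Burton--Keane argument\<close>

text \<open>By transitivity every vertex is a trifurcation with the same probability
  \<open>t\<close>, so the expected number in \<open>F\<close> is \<open>t * card F\<close>. The
  boundary bound makes \<open>t / 2\<close> a lower bound for every boundary ratio.\<close>

lemma amenable_imp_null_trifurcation:
  assumes am: "amenable V E" and x: "x \<in> V"
  shows "prob {\<eta> \<in> space M. trifurcation V (mutual_edges V \<eta>) x} = 0"
proof -
  define T where "T y = {\<eta> \<in> space M. trifurcation V (mutual_edges V \<eta>) y}" for y
  have T: "T y \<in> sets M" for y using pred_trifurcation_mutual_edges by (simp add: T_def pred_def)
  define t where "t = prob (T x)"
  have t: "prob (T y) = t" if "y \<in> V" for y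
  proof -
    obtain f where "graph_automorphism V E f" "f x = y"
      using transitive x \<open>y \<in> V\<close> by (auto simp: vertex_transitive_def)
    then show ?thesis using prob_trifurcation_translate[OF _ x] by (auto simp: t_def T_def)
  qed
  have bound: "t * card F \<le> 2 * card (inner_boundary V E F)" if F: "finite F" "F \<subseteq> V" for F
  proof -
    have "t * card F = (\<Sum>y\<in>F. prob (T y))" using t F by (simp add: subset_iff)
    also have "\<dots> = (\<Sum>y\<in>F. expectation (indicator (T y)))" using T by simp
    also have "\<dots> = expectation (\<lambda>\<eta>. \<Sum>y\<in>F. indicator (T y) \<eta>)"
      using T by (intro Bochner_Integration.integral_sum[symmetric]) (auto simp: emeasure_eq_measure)
    also have "\<dots> \<le> expectation (\<lambda>_. 2 * card (inner_boundary V E F))"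
    proof (rule integral_mono)
      show "integrable M (\<lambda>\<eta>. \<Sum>y\<in>F. indicator (T y) \<eta> :: real)"
        using T by (intro Bochner_Integration.integrable_sum) (auto simp: emeasure_eq_measure)
      fix \<eta> assume \<eta>: "\<eta> \<in> space M"
      have "(\<Sum>y\<in>F. indicator (T y) \<eta> :: real) = card {y \<in> F. \<eta> \<in> T y}"
        using F by (simp add: indicator_def sum.If_cases Int_def)
      also have "{y \<in> F. \<eta> \<in> T y} = {y \<in> F. trifurcation V (mutual_edges V \<eta>) y}"
        using \<eta> by (auto simp: T_def)
      also have "card \<dots> \<le> 2 * card (inner_boundary V E F)"
        using card_trifurcations_le F \<eta> by (simp add: space_M)
      finally show "(\<Sum>y\<in>F. indicator (T y) \<eta>) \<le> real (2 * card (inner_boundary V E F))" by simp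
    qed simp
    finally show ?thesis by (simp add: prob_space)
  qed
  obtain F where F: "\<And>n. F n \<subseteq> V \<and> finite (F n) \<and> F n \<noteq> {}"
    and lim: "limsup (\<lambda>n. ereal (real (card (inner_boundary V E (F n))) / real (card (F n)))) = 0"
    using am by (auto simp: amenable_def)
  have "ereal (t / 2) \<le> ereal (real (card (inner_boundary V E (F n))) / real (card (F n)))" for n
  proof -
    have "card (F n) > 0" using F[of n] by (simp add: card_gt_0_iff)
    then show ?thesis using bound[of "F n"] F[of n] by (simp add: field_simps)
  qed
  then have "limsup (\<lambda>_::nat. ereal (t / 2)) \<le>
      limsup (\<lambda>n. ereal (real (card (inner_boundary V E (F n))) / real (card (F n))))"
    by (intro Limsup_mono always_eventually) simp
  then have "t \<le> 0" by (simp add: lim Limsup_const zero_ereal_def)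
  then have "t = 0" using measure_nonneg[of M "T x"] by (simp add: t_def)
  then show ?thesis by (simp add: t_def T_def)
qed

lemma AE_not_trifurcation:
  assumes "amenable V E"
  shows "AE \<eta> in M. \<forall>x\<in>V. \<not> trifurcation V (mutual_edges V \<eta>) x"
proof -
  have "AE \<eta> in M. \<not> trifurcation V (mutual_edges V \<eta>) x" if "x \<in> V" for x
  proof -
    have "{\<eta> \<in> space M. trifurcation V (mutual_edges V \<eta>) x} \<in> sets M"
      using pred_trifurcation_mutual_edges by (simp add: pred_def)
    from prob_Collect_eq_0[OF this] show ?thesis
      using amenable_imp_null_trifurcation[OF assms that] by simp
  qed
  then show ?thesis using countable_V by (subst AE_ball_countable) auto
qed

section \<open>Uniqueness of the infinite cluster\<close>

lemma unique_infinite_cluster: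
  assumes am: "amenable V E" and pos: "prob {\<eta> \<in> space M. infinite (strong_cluster_of V \<eta> v)} > 0"
    and v: "v \<in> V"
  shows "prob {\<eta> \<in> space M. num_infinite_strong_clusters V \<eta> = 1} = 1"
proof -
  let ?many = "\<lambda>\<eta>. many_infinite (mutual_edges V \<eta>)"
  \<comment> \<open>Positive percolation probability decides the zero-one alternative for
    \<open>m = 1\<close>.\<close>
  have "\<not> (AE \<eta> in M. \<not> ?many \<eta> 1)"
  proof
    assume "AE \<eta> in M. \<not> ?many \<eta> 1"
    then have "AE \<eta> in M. \<not> infinite (strong_cluster_of V \<eta> v)"
      by (rule AE_mp[OF _ AE_I2]) (use v in \<open>auto simp: strong_cluster_of_eq many_infinite_1 simp del: One_nat_def\<close>)
    moreover have ev: "{\<eta> \<in> space M. infinite (strong_cluster_of V \<eta> v)} \<in> sets M"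
      using pred_infinite_cluster[OF countable_V mutual_edges_in_V pred_edge, of v]
      by (simp add: strong_cluster_of_eq[OF v] pred_def)
    ultimately show False using pos prob_Collect_eq_0[OF ev] by simp
  qed
  then have one: "AE \<eta> in M. ?many \<eta> 1" using AE_many_or_not by blast
  have "\<not> (AE \<eta> in M. ?many \<eta> 2)"
  proof
    assume two: "AE \<eta> in M. ?many \<eta> 2"
    \<comment> \<open>Once two infinite clusters are almost sure, so is every number: otherwise the
      count would almost surely be a constant \<open>l \<ge> 2\<close>, which rewiring
      refutes.\<close>
    have "AE \<eta> in M. ?many \<eta> k" for k
    proof (induction k rule: less_induct)
      case (less k)
      show ?case
      proof (cases "k \<le> 2")
        case True
        show ?thesis by (rule AE_mp[OF two AE_I2]) (use True many_infinite_mono in blast)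
      next
        case False
        then obtain l where l: "k = Suc l" "l \<ge> 2" by (cases k) auto
        have "\<not> (AE \<eta> in M. \<not> ?many \<eta> (Suc l))"
        proof
          assume "AE \<eta> in M. \<not> ?many \<eta> (Suc l)"
          then have "AE \<eta> in M. ?many \<eta> l \<and> \<not> ?many \<eta> (Suc l)" using less[of l] l by simp
          then obtain \<G> where "closed_under_upd \<G>" "\<G> \<noteq> {}"
            "\<And>\<eta>. \<eta> \<in> \<G> \<Longrightarrow> ?many \<eta> l \<and> \<not> ?many \<eta> (Suc l)"
            by (rule AE_closed_under_upd) blast
          then show False using no_constant_finite_number l(2) by blast
        qed
        then show ?thesis using AE_many_or_not l(1) by blast
      qed
    qed
    then have "AE \<eta> in M. ?many \<eta> 3 \<and> (\<forall>x\<in>V. \<not> trifurcation V (mutual_edges V \<eta>) x)"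
      using AE_not_trifurcation[OF am] by simp
    then obtain \<G> where \<G>: "closed_under_upd \<G>" "\<G> \<noteq> {}"
      "\<And>\<eta>. \<eta> \<in> \<G> \<Longrightarrow> ?many \<eta> 3 \<and> (\<forall>x\<in>V. \<not> trifurcation V (mutual_edges V \<eta>) x)"
      by (rule AE_closed_under_upd) blast
    then show False using ex_trifurcation[OF \<G>(1)] by blast
  qed
  then have "AE \<eta> in M. \<not> ?many \<eta> 2" using AE_many_or_not by blast
  with one have AE1: "AE \<eta> in M. num_infinite_strong_clusters V \<eta> = 1"
    by (simp add: num_infinite_strong_clusters_eq_1 del: One_nat_def)
  have "{\<eta> \<in> space M. num_infinite_strong_clusters V \<eta> = 1} \<in> sets M"
    using pred_many_infinite_mutual_edges[of 1] pred_many_infinite_mutual_edges[of 2] unfolding num_infinite_strong_clusters_eq_1 by measurable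
  from prob_Collect_eq_1[OF this] show ?thesis using AE1 by simp
qed

end

theorem theorem18:
  fixes V :: "'a set" and E :: "('a \<times> 'a) set" and orig :: 'a
    and d :: nat and p :: "nat \<Rightarrow> real"
  assumes "directed_graph V E orig"
    and "regular_graph V E d"
    and "connected_graph V E"
    and "vertex_transitive V E"
    and "amenable V E"
    and "prob_vector d p"
    and "strong_percolation_prob V E orig d p > 0"
    and "p 0 + p 1 > 0"
    and "p 2 > 0"
    and "(\<Sum>i=3..d. p i) > 0"
  shows "\<P>(\<omega> in config_measure V E d p. num_infinite_strong_clusters V \<omega> = 1) = 1"
proof -
  interpret directed_graph V E orig by fact
  interpret percolation V E d p
    by unfold_locales (use assms E_subset sym_E countable_V infinite_V in auto)
  show ?thesis
    using unique_infinite_cluster[OF assms(5) _ orig_in_V] assms(7)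
    by (simp add: strong_percolation_prob_def)
qed

end
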